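(* Let $\kappa\neq 0$, $n\ge 2$, $m_1,\dots,m_n>0$, and let $0<t^*<\infty$. If $(\mathbf q,\mathbf p)$ is an analytic solution, defined on $[0,t^* )$, of the equations of motion of the curved $n$-body problem on $\mathbf M^2_\kappa$, and $t^*$ is a singularity of this solution, then $$\lim_{t\to t^*}\ \min_{1\le i<j\le n}\big|(\kappa\,\mathbf q_i(t)\odot\mathbf q_j(t))^2-1\big|=0.$$
   Context: Let $\sigma=+1$ if $\kappa>0$ and $\sigma=-1$ if $\kappa<0$. For $\mathbf a=(a_x,a_y,a_z)$, $\mathbf b=(b_x,b_y,b_z)$ in $\mathbb R^3$ put $\mathbf a\odot\mathbf b=a_xb_x+a_yb_y+\sigma a_zb_z$. Let $\mathbf M^2_\kappa=\{(x,y,z)\in\mathbb R^3: \kappa(x^2+y^2+\sigma z^2)=1\}$; this is a sphere for $\kappa>0$, and for $\kappa<0$ only the upper sheet $z>0$ of the hyperboloid is taken. The bodies of masses $m_i$ have positions $\mathbf q_i=(x_i,y_i,z_i)\in\mathbf M^2_\kappa$ and momenta $\mathbf p_i$, $\mathbf q=(\mathbf q_1,\dots,\mathbf q_n)$, $\mathbf p=(\mathbf p_1,\dots,\mathbf p_n)$, subject to $\kappa\,\mathbf q_i\odot\mathbf q_i=1$ and $\mathbf q_i\odot\mathbf p_i=0$ for all $i$. The equations of motion are $$\dot{\mathbf q}_i=m_i^{-1}\mathbf p_i,\qquad \dot{\mathbf p}_i=\bar\nabla_{\mathbf q_i}U_\kappa(\mathbf q)-m_i^{-1}\kappa(\mathbf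 p_i\odot\mathbf p_i)\mathbf q_i,\qquad i=1,\dots,n,$$ where $$\bar\nabla_{\mathbf q_i}U_\kappa(\mathbf q)=\sum_{j\ne i}\frac{m_im_j(\sigma\kappa)^{3/2}(\kappa\mathbf q_j\odot\mathbf q_j)[(\kappa\mathbf q_i\odot\mathbf q_i)\mathbf q_j-(\kappa\mathbf q_i\odot\mathbf q_j)\mathbf q_i]}{[\sigma(\kappa\mathbf q_i\odot\mathbf q_i)(\kappa\mathbf q_j\odot\mathbf q_j)-\sigma(\kappa\mathbf q_i\odot\mathbf q_j)^2]^{3/2}}.$$ The equations are undefined on the set $\mathbf\Delta$ of configurations with $(\kappa\mathbf q_i\odot\mathbf q_j)^2=1$ for some $i<j$; a solution on $[0,t^* )$ satisfies $\mathbf q(t)\notin\mathbf\Delta$ for $t\in[0,t^* )$. A finite time $t^*$ is a singularity of a solution defined on $[0,t^* )$ if the solution cannot be extended analytically to an interval $[0,t')$ with $t'>t^*$. *)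

theory Defs
  imports "HOL-Analysis.Analysis"
begin

definition sig :: "real \<Rightarrow> real" where
  "sig \<kappa> = (if \<kappa> > 0 then 1 else -1)"

definition odot :: "real \<Rightarrow> real ^ 3 \<Rightarrow> real ^ 3 \<Rightarrow> real" where
  "odot \<kappa> a b = a $ 1 * b $ 1 + a $ 2 * b $ 2 + sig \<kappa> * a $ 3 * b $ 3"

definition M2 :: "real \<Rightarrow> (real ^ 3) set" where
  "M2 \<kappa> = {v. \<kappa> * ((v $ 1)\<^sup>2 + (v $ 2)\<^sup>2 + sig \<kappa> * (v $ 3)\<^sup>2) = 1 \<and> (\<kappa> < 0 \<longrightarrow> v $ 3 > 0)}"

(* A configuration is a map nat => real ^ 3 of which only the values at the
   body indices 1, ..., n matter. *)

definition grad_U :: "real \<Rightarrow> nat \<Rightarrow> (nat \<Rightarrow> real) \<Rightarrow> (nat \<Rightarrow> real ^ 3) \<Rightarrow> nat \<Rightarrow> real ^ 3" where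
  "grad_U \<kappa> n m q i =
     (\<Sum>j \<in> {1..n} - {i}.
        (m i * m j * (sig \<kappa> * \<kappa>) powr (3/2) * (\<kappa> * odot \<kappa> (q j) (q j))
          / (sig \<kappa> * (\<kappa> * odot \<kappa> (q i) (q i)) * (\<kappa> * odot \<kappa> (q j) (q j))
              - sig \<kappa> * (\<kappa> * odot \<kappa> (q i) (q j))\<^sup>2) powr (3/2))
        *\<^sub>R ((\<kappa> * odot \<kappa> (q i) (q i)) *\<^sub>R q j - (\<kappa> * odot \<kappa> (q i) (q j)) *\<^sub>R q i))"

definition singular_set :: "real \<Rightarrow> nat \<Rightarrow> (nat \<Rightarrow> real ^ 3) set" where
  "singular_set \<kappa> n =
     {q. \<exists>i j. 1 \<le> i \<and> i < j \<and> j \<le> n \<and> (\<kappa> * odot \<kappa> (q i) (q j))\<^sup>2 = 1}"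

definition solution_on ::
  "real \<Rightarrow> nat \<Rightarrow> (nat \<Rightarrow> real) \<Rightarrow> real set \<Rightarrow> (real \<Rightarrow> nat \<Rightarrow> real ^ 3) \<Rightarrow> (real \<Rightarrow> nat \<Rightarrow> real ^ 3) \<Rightarrow> bool"
where
  "solution_on \<kappa> n m I q p \<longleftrightarrow>
     (\<forall>t\<in>I. q t \<notin> singular_set \<kappa> n) \<and>
     (\<forall>i\<in>{1..n}. \<forall>t\<in>I.
        q t i \<in> M2 \<kappa> \<and> odot \<kappa> (q t i) (p t i) = 0 \<and>
        ((\<lambda>s. q s i) has_vector_derivative (1 / m i) *\<^sub>R p t i) (at t within I) \<and>
        ((\<lambda>s. p s i) has_vector_derivative
           (grad_U \<kappa> n m (q t) i - ((1 / m i) * \<kappa> * odot \<kappa> (p t i) (p t i)) *\<^sub>R q t i)) (at t within I))"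

(* At an endpoint belonging to the interval S the expansion is only required
   to represent f on the side lying in S. *)
definition real_analytic_on :: "(real \<Rightarrow> 'a::real_normed_vector) \<Rightarrow> real set \<Rightarrow> bool" where
  "real_analytic_on f S \<longleftrightarrow>
     (\<forall>t0\<in>S. \<exists>r>0. \<exists>a :: nat \<Rightarrow> 'a. \<forall>t\<in>S. \<bar>t - t0\<bar> < r \<longrightarrow>
        (\<lambda>k. (t - t0) ^ k *\<^sub>R a k) sums f t)"

definition analytic_solution_on ::
  "real \<Rightarrow> nat \<Rightarrow> (nat \<Rightarrow> real) \<Rightarrow> real set \<Rightarrow> (real \<Rightarrow> nat \<Rightarrow> real ^ 3) \<Rightarrow> (real \<Rightarrow> nat \<Rightarrow> real ^ 3) \<Rightarrow> bool"
where
  "analytic_solution_on \<kappa> n m I q p \<longleftrightarrow>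
     solution_on \<kappa> n m I q p \<and>
     (\<forall>i\<in>{1..n}. real_analytic_on (\<lambda>t. q t i) I \<and> real_analytic_on (\<lambda>t. p t i) I)"

(* The extension is required to be a solution again, so in particular to avoid
   the singular set. Asking only for analytic functions extending q and p would
   make fewer times singular. *)
definition singularity ::
  "real \<Rightarrow> nat \<Rightarrow> (nat \<Rightarrow> real) \<Rightarrow> (real \<Rightarrow> nat \<Rightarrow> real ^ 3) \<Rightarrow> (real \<Rightarrow> nat \<Rightarrow> real ^ 3) \<Rightarrow> real \<Rightarrow> bool"
where
  "singularity \<kappa> n m q p tstar \<longleftrightarrow>
     \<not> (\<exists>t' Q P. t' > tstar \<and> analytic_solution_on \<kappa> n m {0..<t'} Q P \<and>
          (\<forall>t\<in>{0..<tstar}. \<forall>i\<in>{1..n}. Q t i = q t i \<and> P t i = p t i))"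

end

theory Submission
  imports Defs "HOL-Complex_Analysis.Conformal_Mappings"
begin

text \<open>
  Suppose that the limit is not zero. Then there are times arbitrarily close to \<open>t*\<close> at which all
  pairs keep a fixed distance from the singular set, measured by
  \<open>s = \<sigma>(1 - c\<^sup>2) = \<bar>c\<^sup>2 - 1\<bar>\<close> with \<open>c = \<kappa> q\<^sub>i \<odot> q\<^sub>j\<close>. At such a time the potential, a sum of terms
  proportional to \<open>c / sqrt s\<close>, is bounded, so conservation of energy bounds all the speeds. A bounded
  speed bounds the rate of change of \<open>ln (1 + s)\<close>, uniformly even on the unbounded hyperbolic plane
  (\<open>ln_gap_lipschitz\<close>). Hence, once such a time is close enough to \<open>t*\<close>, the separation persists
  up to \<open>t*\<close> (\<open>separation_persists\<close>): the bound on \<open>s\<close> gives the bound on the speeds, which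
  in the remaining time is not enough to halve the lower bound on \<open>s\<close>. After that all positions,
  momenta and the quantities \<open>1 / sqrt s\<close> stay bounded (\<open>coords_bounded\<close>); in the hyperbolic case
  the Lorentzian form controls the Euclidean size because a bounded speed can only move the bodies a
  bounded distance.

  It remains to see that a solution whose coordinates stay bounded extends analytically. No
  existence theorem for differential equations enters. With \<open>w = 1 / sqrt s\<close> adjoined as an
  additional coordinate, the equations of motion become polynomial. For polynomial equations, the
  \<open>k\<close>-th derivative of a bounded solution is at most \<open>A k! R\<^sup>k\<close> with constants that do not depend
  on time (\<open>polys_derivs_bound\<close>), so the Taylor series at a time close enough to \<open>t*\<close> converges
  beyond \<open>t*\<close> (\<open>polynomial_ode_extension\<close>). The equations of motion, the constraints and the
  relation \<open>w\<^sup>2 s = 1\<close>, which keeps the extension away from the singular set, are identities between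
  analytic functions; they hold before \<open>t*\<close> and therefore also after it
  (\<open>analytic_extension\<close>). So \<open>t*\<close> is not a singularity.
\<close>

section \<open>Derivatives of bounded solutions of polynomial equations\<close>

text \<open>
  A function satisfies \<open>poly_bd G d L\<close> if it is a polynomial of degree at most \<open>d\<close> in the functions
  in \<open>G\<close> whose coefficients have absolute values with sum at most \<open>L\<close>. Presenting polynomials by
  this closure, and not by their coefficients, makes differentiation a plain induction. The degree
  and the norm are carried along because they determine how fast the iterated derivatives grow.
\<close>
inductive poly_bd :: "(real \<Rightarrow> real) set \<Rightarrow> nat \<Rightarrow> real \<Rightarrow> (real \<Rightarrow> real) \<Rightarrow> bool"
  for G where
  gen: "g \<in> G \<Longrightarrow> poly_bd G 1 1 g"
| const: "poly_bd G 0 \<bar>c\<bar> (\<lambda>t. c)"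
| add: "poly_bd G d K f \<Longrightarrow> poly_bd G d L g \<Longrightarrow> poly_bd G d (K + L) (\<lambda>t. f t + g t)"
| mult: "poly_bd G d K f \<Longrightarrow> poly_bd G e L g \<Longrightarrow> poly_bd G (d + e) (K * L) (\<lambda>t. f t * g t)"
| weaken: "poly_bd G d K f \<Longrightarrow> d \<le> e \<Longrightarrow> K \<le> L \<Longrightarrow> poly_bd G e L f"

lemma poly_bd_nonneg: "poly_bd G d L f \<Longrightarrow> 0 \<le> L"
  by (induction rule: poly_bd.induct) auto

lemma poly_bd_bound:
  assumes "poly_bd G d L f" "1 \<le> M" "\<And>g. g \<in> G \<Longrightarrow> \<bar>g t\<bar> \<le> M"
  shows "\<bar>f t\<bar> \<le> L * M ^ d"
  using assms(1)
proof induction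
  case (gen g) then show ?case using assms(3) by simp
next
  case (const c) then show ?case by simp
next
  case (add d K f L g)
  then show ?case by (auto simp: distrib_right)
next
  case (mult d K f e L g)
  have "\<bar>f t * g t\<bar> \<le> (K * M ^ d) * (L * M ^ e)"
    unfolding abs_mult
    by (rule mult_mono) (use mult assms(2) poly_bd_nonneg in auto)
  then show ?case by (simp add: power_add mult_ac)
next
  case (weaken d K f e L)
  have "K * M ^ d \<le> L * M ^ e"
    by (rule mult_mono)
      (use weaken assms(2) poly_bd_nonneg[OF weaken.hyps(1)] in \<open>auto intro: power_increasing\<close>)
  with weaken show ?case by linarith
qed

text \<open>
  If differentiating a generator raises the degree by \<open>D\<close> and the norm by a factor \<open>C\<close>, then by the
  Leibniz rule a monomial of degree \<open>d\<close> has a derivative with \<open>d\<close> such terms. The degree \<open>d\<close> thus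
  appears as a factor of the norm; in iterated derivatives these factors grow linearly and multiply
  up to a factorial.
\<close>
lemma poly_bd_deriv:
  assumes "poly_bd G d L f" and "0 \<le> C"
    and gen: "\<And>g. g \<in> G \<Longrightarrow> \<exists>g'. poly_bd G (Suc D) C g' \<and> (\<forall>t\<in>J. (g has_real_derivative g' t) (at t))"
  shows "\<exists>f'. poly_bd G (d + D) (L * real d * C) f' \<and> (\<forall>t\<in>J. (f has_real_derivative f' t) (at t))"
  using assms(1)
proof induction
  case (gen g)
  then show ?case using assms(3)[of g] by auto
next
  case (const c)
  have "poly_bd G 0 0 (\<lambda>t. 0)" using poly_bd.const[of G 0] by simp
  then have "poly_bd G D 0 (\<lambda>t. 0)" by (rule poly_bd.weaken) auto
  then show ?case by (intro exI[of _ "\<lambda>t. 0"]) auto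
next
  case (add d K f L g)
  then obtain f' g' where
    "poly_bd G (d + D) (K * real d * C) f'" "\<forall>t\<in>J. (f has_real_derivative f' t) (at t)"
    "poly_bd G (d + D) (L * real d * C) g'" "\<forall>t\<in>J. (g has_real_derivative g' t) (at t)"
    by blast
  then show ?case
    by (intro exI[of _ "\<lambda>t. f' t + g' t"])
      (auto intro!: derivative_eq_intros poly_bd.weaken[OF poly_bd.add[of G "d + D" _ f' _ g']] simp: algebra_simps)
next
  case (mult d K f e L g)
  then obtain f' g' where d:
    "poly_bd G (d + D) (K * real d * C) f'" "\<forall>t\<in>J. (f has_real_derivative f' t) (at t)"
    "poly_bd G (e + D) (L * real e * C) g'" "\<forall>t\<in>J. (g has_real_derivative g' t) (at t)"
    by blast
  have 1: "poly_bd G (d + e + D) (K * real d * C * L) (\<lambda>t. f' t * g t)"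
    using poly_bd.mult[OF d(1) mult.hyps(2)] by (simp add: add_ac)
  have 2: "poly_bd G (d + e + D) (K * (L * real e * C)) (\<lambda>t. f t * g' t)"
    using poly_bd.mult[OF mult.hyps(1) d(3)] by (simp add: add_ac)
  have "poly_bd G (d + e + D) (K * L * real (d + e) * C) (\<lambda>t. f' t * g t + f t * g' t)"
    by (rule poly_bd.weaken[OF poly_bd.add[OF 1 2]]) (auto simp: algebra_simps)
  then show ?case using d(2,4)
    by (intro exI[of _ "\<lambda>t. f' t * g t + f t * g' t"])
      (auto intro!: derivative_eq_intros)
next
  case (weaken d K f e L)
  then obtain f' where f': "poly_bd G (d + D) (K * real d * C) f'"
    "\<forall>t\<in>J. (f has_real_derivative f' t) (at t)" by blast
  have "K * real d \<le> L * real e"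
    by (rule mult_mono) (use weaken.hyps poly_bd_nonneg[OF weaken.hyps(1)] in auto)
  then have "K * real d * C \<le> L * real e * C"
    using assms(2) by (rule mult_right_mono)
  with f' weaken.hyps show ?case
    by (intro exI[of _ f']) (auto intro: poly_bd.weaken)
qed

definition polys :: "(real \<Rightarrow> real) set \<Rightarrow> (real \<Rightarrow> real) set" where
  "polys G = {f. \<exists>d L. poly_bd G d L f}"

lemma polys_gen: "g \<in> G \<Longrightarrow> g \<in> polys G"
  unfolding polys_def by (auto intro: poly_bd.gen)

lemma polys_const: "(\<lambda>t. c) \<in> polys G"
  unfolding polys_def by (auto intro: poly_bd.const)

lemma polys_mult: "f \<in> polys G \<Longrightarrow> g \<in> polys G \<Longrightarrow> (\<lambda>t. f t * g t) \<in> polys G"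
  unfolding polys_def by (auto intro: poly_bd.mult)

lemma polys_add:
  assumes "f \<in> polys G" "g \<in> polys G" shows "(\<lambda>t. f t + g t) \<in> polys G"
proof -
  obtain d K e L where "poly_bd G d K f" "poly_bd G e L g"
    using assms unfolding polys_def by auto
  then have "poly_bd G (max d e) K f" "poly_bd G (max d e) L g"
    by (auto intro: poly_bd.weaken)
  from poly_bd.add[OF this] show ?thesis unfolding polys_def by auto
qed

lemma polys_diff:
  assumes "f \<in> polys G" "g \<in> polys G" shows "(\<lambda>t. f t - g t) \<in> polys G"
  using polys_add[OF assms(1) polys_mult[OF polys_const[of "-1"] assms(2)]] by simp

lemma polys_power:
  assumes "f \<in> polys G" shows "(\<lambda>t. f t ^ k) \<in> polys G"
  by (induction k) (auto intro: polys_const polys_mult assms)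

lemma polys_sum:
  assumes "\<And>i. i \<in> A \<Longrightarrow> f i \<in> polys G" shows "(\<lambda>t. \<Sum>i\<in>A. f i t) \<in> polys G"
  using assms
  by (induction A rule: infinite_finite_induct) (auto intro: polys_const polys_add)

lemmas polys_intros = polys_const polys_add polys_diff polys_mult polys_power polys_sum

text \<open>
  The estimate of Cauchy type that makes solutions analytic with a uniform radius of convergence.
  The \<open>k\<close>-th derivative of a generator has degree at most \<open>1 + k D\<close> and norm at most
  \<open>\<Prod>j<k. (1 + j D) C \<le> k! (C (D + 1))\<^sup>k\<close>, and a bound \<open>M \<ge> 1\<close> for all generators turns this
  into a bound for its values.
\<close>
lemma polys_derivs_bound:
  assumes fin: "finite G"
    and der: "\<And>g. g \<in> G \<Longrightarrow> \<exists>g'\<in>polys G. \<forall>t\<in>J. (g has_real_derivative g' t) (at t)"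
    and bd: "\<And>g. g \<in> G \<Longrightarrow> \<exists>M. \<forall>t\<in>J. \<bar>g t\<bar> \<le> M"
  shows "\<exists>A R. 0 < R \<and> (\<forall>g\<in>G. \<exists>df. df 0 = g \<and>
     (\<forall>k. \<forall>t\<in>J. (df k has_real_derivative df (Suc k) t) (at t) \<and> \<bar>df k t\<bar> \<le> A * fact k * R ^ k))"
proof -
  obtain g' where g': "\<And>g. g \<in> G \<Longrightarrow> g' g \<in> polys G"
    "\<And>g t. g \<in> G \<Longrightarrow> t \<in> J \<Longrightarrow> (g has_real_derivative g' g t) (at t)"
    using der by metis
  obtain d L where dL: "\<And>g. g \<in> G \<Longrightarrow> poly_bd G (d g) (L g) (g' g)"
    using g'(1) unfolding polys_def mem_Collect_eq by metis
  obtain B where B: "\<And>g t. g \<in> G \<Longrightarrow> t \<in> J \<Longrightarrow> \<bar>g t\<bar> \<le> B g"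
    using bd by metis
  define D where "D = (\<Sum>g\<in>G. d g)"
  define C where "C = 1 + (\<Sum>g\<in>G. L g)"
  define M where "M = 1 + (\<Sum>g\<in>G. \<bar>B g\<bar>)"
  have Lnn: "L g \<ge> 0" if "g \<in> G" for g using dL[OF that] poly_bd_nonneg by blast
  have "C \<ge> 1" unfolding C_def using Lnn by (simp add: sum_nonneg)
  have M1: "M \<ge> 1" unfolding M_def by (simp add: sum_nonneg)
  have dD: "d g \<le> D" if "g \<in> G" for g unfolding D_def using that fin by (simp add: member_le_sum)
  have LC: "L g \<le> C" if "g \<in> G" for g
    unfolding C_def using member_le_sum[of g G L] that fin Lnn by force
  have gM: "\<bar>g t\<bar> \<le> M" if "g \<in> G" "t \<in> J" for g t
    unfolding M_def using member_le_sum[of g G "\<lambda>g. \<bar>B g\<bar>"] that fin B[OF that] by force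
  have gen: "\<exists>g'. poly_bd G (Suc D) C g' \<and> (\<forall>t\<in>J. (g has_real_derivative g' t) (at t))"
    if "g \<in> G" for g
    using poly_bd.weaken[OF dL[OF that], of "Suc D" C] dD[OF that] LC[OF that] g'(2) that by force
  \<comment> \<open>Each derivative costs the factor \<open>C (D + 1)\<close> from the norm, besides the factorial, and a factor
    \<open>M\<^sup>D\<close> from the degree.\<close>
  define R where "R = C * real (Suc D) * M ^ D"
  define lam where "lam k = fact k * (C * real (Suc D)) ^ k" for k
  have ex: "\<exists>df. df 0 = g \<and> (\<forall>k. poly_bd G (1 + k * D) (lam k) (df k) \<and>
       (\<forall>t\<in>J. (df k has_real_derivative df (Suc k) t) (at t)))" if g: "g \<in> G" for g
  proof -
    have "\<exists>df. \<forall>k. (poly_bd G (1 + k * D) (lam k) (df k) \<and> (k = 0 \<longrightarrow> df k = g)) \<and>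
        (\<forall>t\<in>J. (df k has_real_derivative df (Suc k) t) (at t))"
    proof (rule dependent_nat_choice)
      show "\<exists>f. poly_bd G (1 + 0 * D) (lam 0) f \<and> ((0::nat) = 0 \<longrightarrow> f = g)"
        using poly_bd.gen[OF g] by (auto simp: lam_def)
    next
      fix f k assume "poly_bd G (1 + k * D) (lam k) f \<and> (k = 0 \<longrightarrow> f = g)"
      then obtain f' where f': "poly_bd G (1 + k * D + D) (lam k * real (1 + k * D) * C) f'"
        "\<forall>t\<in>J. (f has_real_derivative f' t) (at t)"
        using poly_bd_deriv[OF _ _ gen, of "1 + k * D" "lam k" f] \<open>C \<ge> 1\<close> by auto
      have "real (1 + k * D) \<le> real (Suc k * Suc D)" by (rule of_nat_mono) simp
      then have "(lam k * C) * real (1 + k * D) \<le> (lam k * C) * real (Suc k * Suc D)"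
        by (rule mult_left_mono) (use \<open>C \<ge> 1\<close> in \<open>simp add: lam_def\<close>)
      also have "\<dots> = lam (Suc k)" by (simp add: lam_def algebra_simps)
      finally have "poly_bd G (1 + Suc k * D) (lam (Suc k)) f'"
        by (intro poly_bd.weaken[OF f'(1)]) (auto simp: mult_ac)
      with f'(2) show "\<exists>f'. (poly_bd G (1 + Suc k * D) (lam (Suc k)) f' \<and> (Suc k = 0 \<longrightarrow> f' = g)) \<and>
         (\<forall>t\<in>J. (f has_real_derivative f' t) (at t))" by auto
    qed
    then obtain df where "\<forall>k. (poly_bd G (1 + k * D) (lam k) (df k) \<and> (k = 0 \<longrightarrow> df k = g)) \<and>
        (\<forall>t\<in>J. (df k has_real_derivative df (Suc k) t) (at t))" by blast
    then show ?thesis by (intro exI[of _ df]) blast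
  qed
  have bound: "\<bar>f t\<bar> \<le> M * fact k * R ^ k" if "poly_bd G (1 + k * D) (lam k) f" "t \<in> J" for f k t
  proof -
    have "\<bar>f t\<bar> \<le> lam k * M ^ (1 + k * D)"
      by (rule poly_bd_bound[OF that(1) M1 gM[OF _ that(2)]])
    also have "\<dots> = M * fact k * R ^ k"
      by (simp add: lam_def R_def power_mult_distrib power_mult[symmetric] mult_ac)
    finally show ?thesis .
  qed
  show ?thesis
  proof (rule exI[of _ M], rule exI[of _ R], intro conjI ballI)
    show "R > 0" unfolding R_def using \<open>C \<ge> 1\<close> M1 by simp
    fix g assume g: "g \<in> G"
    show "\<exists>df. df 0 = g \<and> (\<forall>k. \<forall>t\<in>J. (df k has_real_derivative df (Suc k) t) (at t) \<and>
        \<bar>df k t\<bar> \<le> M * fact k * R ^ k)"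
    proof -
      obtain df where "df 0 = g" "\<forall>k. poly_bd G (1 + k * D) (lam k) (df k) \<and>
          (\<forall>t\<in>J. (df k has_real_derivative df (Suc k) t) (at t))"
        using ex[OF g] by blast
      then show ?thesis using bound by (intro exI[of _ df]) blast
    qed
  qed
qed

section \<open>Real functions with a holomorphic extension to a disc\<close>

text \<open>
  Real-analytic functions on an interval around \<open>c\<close> are handled as restrictions of holomorphic
  functions on one fixed disc. This makes the identity theorem and the power series expansion at
  every point of the interval available without manipulating real power series.
\<close>

definition holo_ext :: "real \<Rightarrow> real \<Rightarrow> (real \<Rightarrow> real) \<Rightarrow> bool" where
  "holo_ext c r f \<longleftrightarrow> (\<exists>F. F holomorphic_on ball (complex_of_real c) r \<and>
     (\<forall>t\<in>ball c r. F (of_real t) = of_real (f t)))"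

lemma of_real_in_ball [simp]: "complex_of_real t \<in> ball (of_real c) r \<longleftrightarrow> t \<in> ball c r"
  by (simp add: dist_of_real)

lemma holo_ext_const: "holo_ext c r (\<lambda>t. a)"
  unfolding holo_ext_def by (intro exI[of _ "\<lambda>z. of_real a"]) auto

lemma holo_ext_add:
  "holo_ext c r f \<Longrightarrow> holo_ext c r g \<Longrightarrow> holo_ext c r (\<lambda>t. f t + g t)"
  unfolding holo_ext_def
  apply clarify
  subgoal for F H by (intro exI[of _ "\<lambda>z. F z + H z"]) (auto intro: holomorphic_intros)
  done

lemma holo_ext_mult:
  "holo_ext c r f \<Longrightarrow> holo_ext c r g \<Longrightarrow> holo_ext c r (\<lambda>t. f t * g t)"
  unfolding holo_ext_def
  apply clarify
  subgoal for F H by (intro exI[of _ "\<lambda>z. F z * H z"]) (auto intro: holomorphic_intros)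
  done

lemma holo_ext_diff:
  assumes "holo_ext c r f" "holo_ext c r g" shows "holo_ext c r (\<lambda>t. f t - g t)"
  using holo_ext_add[OF assms(1) holo_ext_mult[OF holo_ext_const[of _ _ "-1"] assms(2)]] by simp

lemma holo_ext_power: "holo_ext c r f \<Longrightarrow> holo_ext c r (\<lambda>t. f t ^ k)"
  by (induction k) (auto intro: holo_ext_const holo_ext_mult)

lemma holo_ext_sum:
  "(\<And>i. i \<in> A \<Longrightarrow> holo_ext c r (f i)) \<Longrightarrow> holo_ext c r (\<lambda>t. \<Sum>i\<in>A. f i t)"
  by (induction A rule: infinite_finite_induct) (auto intro: holo_ext_const holo_ext_add)

lemmas holo_ext_intros =
  holo_ext_const holo_ext_add holo_ext_diff holo_ext_mult holo_ext_power holo_ext_sum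

text \<open>
  The complex derivative of an extension is real on the real axis, where it is the real derivative;
  so differentiation does not leave the class or shrink the disc.
\<close>
lemma holo_ext_deriv:
  assumes "holo_ext c r f"
  obtains f' where "holo_ext c r f'"
    "\<And>t. t \<in> ball c r \<Longrightarrow> (f has_real_derivative f' t) (at t)"
proof -
  obtain F where F: "F holomorphic_on ball (of_real c) r"
      "\<And>t. t \<in> ball c r \<Longrightarrow> F (of_real t) = of_real (f t)"
    using assms unfolding holo_ext_def by auto
  have v: "((\<lambda>s. complex_of_real (f s)) has_vector_derivative deriv F (of_real t)) (at t)"
    if t: "t \<in> ball c r" for t
  proof -
    have "(F has_field_derivative deriv F (of_real t)) (at (of_real t))"
      by (rule holomorphic_derivI[OF F(1)]) (use t in auto)
    then have "((\<lambda>s. F (of_real s)) has_vector_derivative deriv F (of_real t)) (at t)"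
      by (rule has_vector_derivative_real_field)
    then show ?thesis
      by (rule has_vector_derivative_transform_within_open[of _ _ _ "ball c r"])
        (use t F(2) in auto)
  qed
  have re: "(f has_real_derivative Re (deriv F (of_real t))) (at t)" if "t \<in> ball c r" for t
    using bounded_linear.has_vector_derivative[OF bounded_linear_Re v[OF that]]
    by (simp add: has_real_derivative_iff_has_vector_derivative)
  have "Im (deriv F (of_real t)) = 0" if "t \<in> ball c r" for t
    using bounded_linear.has_vector_derivative[OF bounded_linear_Im v[OF that]]
    by (simp add: vector_derivative_unique_at[OF _ has_vector_derivative_const])
  then have "deriv F (of_real t) = of_real (Re (deriv F (of_real t)))" if "t \<in> ball c r" for t
    using that by (simp add: complex_eq_iff)
  moreover have "deriv F holomorphic_on ball (of_real c) r"
    by (rule holomorphic_deriv[OF F(1)]) auto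
  ultimately have "holo_ext c r (\<lambda>t. Re (deriv F (of_real t)))"
    unfolding holo_ext_def by blast
  with re show ?thesis using that by blast
qed

lemma holo_ext_continuous:
  assumes "holo_ext c r f" shows "continuous_on (ball c r) f"
proof -
  obtain f' where "\<And>t. t \<in> ball c r \<Longrightarrow> (f has_real_derivative f' t) (at t)"
    using holo_ext_deriv[OF assms] by blast
  then show ?thesis
    by (intro continuous_at_imp_continuous_on ballI) (blast intro: DERIV_isCont)
qed

text \<open>
  The principle by which the equations of motion and the constraints pass beyond the time \<open>t*\<close>.
\<close>
lemma holo_ext_identity:
  assumes f: "holo_ext c r f" and g: "holo_ext c r g"
    and ab: "a < b" "{a<..<b} \<subseteq> ball c r" "\<And>t. t \<in> {a<..<b} \<Longrightarrow> f t = g t"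
    and t: "t \<in> ball c r"
  shows "f t = g t"
proof -
  obtain F where F: "F holomorphic_on ball (of_real c) r"
      "\<And>t. t \<in> ball c r \<Longrightarrow> F (of_real t) = of_real (f t - g t)"
    using holo_ext_diff[OF f g] unfolding holo_ext_def by auto
  define x where "x = (a + b) / 2"
  have x: "x \<in> {a<..<b}" using ab(1) by (auto simp: x_def)
  have "F (of_real t) = 0"
  proof (rule analytic_continuation[OF F(1)])
    show "complex_of_real ` {a<..<b} \<subseteq> ball (of_real c) r" using ab(2) by auto
    show "complex_of_real x \<in> ball (of_real c) r" using ab(2) x by auto
    have "x islimpt {a<..<b}" using x by (simp add: interior_limit_point)
    then show "complex_of_real x islimpt complex_of_real ` {a<..<b}"
      by (auto simp: islimpt_approachable dist_of_real)
    show "F z = 0" if "z \<in> complex_of_real ` {a<..<b}" for z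
      using that F(2) ab(2,3) by force
  qed (use t in auto)
  with F(2)[OF t] show ?thesis by (metis of_real_eq_0_iff right_minus_eq)
qed

lemma holo_ext_pos:
  assumes f: "holo_ext c r f" and nz: "\<And>t. t \<in> ball c r \<Longrightarrow> f t \<noteq> 0"
    and s: "s \<in> ball c r" "f s > 0" and t: "t \<in> ball c r"
  shows "f t > 0"
proof (rule ccontr)
  assume "\<not> f t > 0"
  have "connected (f ` ball c r)"
    using holo_ext_continuous[OF f] by (rule connected_continuous_image) auto
  then have "0 \<in> f ` ball c r"
    using connected_contains_Icc[of "f ` ball c r" "f t" "f s"] \<open>\<not> f t > 0\<close> s t by auto
  then show False using nz by auto
qed

lemma holo_ext_power_series:
  assumes "holo_ext c r f" and "s \<in> ball c r"
  obtains \<rho> a where "0 < \<rho>" "\<And>t. \<bar>t - s\<bar> < \<rho> \<Longrightarrow> (\<lambda>k. (t - s) ^ k * a k) sums f t"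
proof -
  obtain F where F: "F holomorphic_on ball (of_real c) r"
      "\<And>t. t \<in> ball c r \<Longrightarrow> F (of_real t) = of_real (f t)"
    using assms unfolding holo_ext_def by auto
  define \<rho> where "\<rho> = r - dist c s"
  have sub: "ball (complex_of_real s) \<rho> \<subseteq> ball (of_real c) r" "ball s \<rho> \<subseteq> ball c r"
    by (auto simp: \<rho>_def subset_iff)
      (metis dist_commute dist_of_real dist_triangle_lt less_diff_eq add.commute, metis dist_commute dist_triangle_lt less_diff_eq add.commute)
  define b where "b k = (deriv ^^ k) F (of_real s) / fact k" for k
  have "(\<lambda>k. (t - s) ^ k * Re (b k)) sums f t" if "\<bar>t - s\<bar> < \<rho>" for t
  proof -
    have t: "t \<in> ball s \<rho>" using that by (simp add: dist_real_def abs_minus_commute)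
    have "(\<lambda>k. b k * (of_real t - of_real s) ^ k) sums F (of_real t)"
      unfolding b_def
      by (rule holomorphic_power_series[OF holomorphic_on_subset[OF F(1) sub(1)]]) (use t in simp)
    then have "(\<lambda>k. Re (b k * of_real ((t - s) ^ k))) sums Re (F (of_real t))"
      by (intro sums_Re) simp
    moreover have "Re (F (of_real t)) = f t" using F(2)[of t] t sub(2) by auto
    ultimately show ?thesis by (simp add: mult.commute)
  qed
  moreover have "\<rho> > 0" using assms(2) by (simp add: \<rho>_def)
  ultimately show ?thesis using that[of \<rho> "\<lambda>k. Re (b k)"] by simp
qed

text \<open>
  The bound \<open>A k! R\<^sup>k\<close> makes the Taylor series converge on the disc of radius \<open>1 / R\<close>. The same bound
  at all points of \<open>J\<close>, and not only at \<open>c\<close>, lets the Lagrange remainder tend to zero, so that the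
  series represents the function on \<open>J\<close>.
\<close>
lemma taylor_holo_ext:
  assumes "0 < R" "r \<le> 1 / R" and J: "is_interval J" "c \<in> J"
    and der: "\<And>k t. t \<in> J \<Longrightarrow> (df k has_real_derivative df (Suc k) t) (at t)"
    and bd: "\<And>k t. t \<in> J \<Longrightarrow> \<bar>df k t\<bar> \<le> A * fact k * R ^ k"
  shows "\<exists>h. holo_ext c r h \<and> (\<forall>t \<in> J \<inter> ball c r. h t = df 0 t)"
proof -
  define a where "a k = df k c / fact k" for k
  have a: "\<bar>a k\<bar> \<le> A * R ^ k" for k
    unfolding a_def using bd[OF J(2), of k] by (simp add: field_simps)
  have A: "A \<ge> 0" using a[of 0] by simp
  have geo: "R * x < 1" if "x < r" for x
  proof -
    have "x < 1 / R" using that assms(2) by linarith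
    then show ?thesis using \<open>0 < R\<close> by (simp add: field_simps)
  qed
  define F where "F z = (\<Sum>k. complex_of_real (a k) * (z - of_real c) ^ k)" for z
  have sums: "(\<lambda>k. complex_of_real (a k) * (z - of_real c) ^ k) sums F z"
    if "z \<in> ball (of_real c) r" for z
    unfolding F_def
  proof (rule summable_sums, rule summable_comparison_test')
    define x where "x = norm (z - of_real c)"
    have "x < r" using that by (simp add: x_def dist_norm norm_minus_commute)
    then show "summable (\<lambda>k. A * (R * x) ^ k)"
      using geo[of x] \<open>0 < R\<close> by (intro summable_mult summable_geometric) (simp add: abs_mult x_def)
    show "norm (complex_of_real (a k) * (z - of_real c) ^ k) \<le> A * (R * x) ^ k" for k
    proof -
      have "\<bar>a k\<bar> * x ^ k \<le> A * R ^ k * x ^ k"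
        by (intro mult_right_mono a) (simp add: x_def)
      then show ?thesis by (simp add: norm_mult norm_power x_def power_mult_distrib mult_ac)
    qed
  qed
  have "F holomorphic_on ball (of_real c) r"
    using sums by (rule power_series_holomorphic)
  moreover have real_sums: "(\<lambda>k. a k * (t - c) ^ k) sums Re (F (of_real t))"
    "F (of_real t) = of_real (Re (F (of_real t)))" if "t \<in> ball c r" for t
  proof -
    have s: "(\<lambda>k. of_real (a k * (t - c) ^ k)) sums F (of_real t)"
      using sums[of "of_real t"] that by simp
    then show "(\<lambda>k. a k * (t - c) ^ k) sums Re (F (of_real t))"
      using sums_Re[OF s] by simp
    show "F (of_real t) = of_real (Re (F (of_real t)))"
      using sums_Im[OF s] by (simp add: complex_eq_iff sums_unique2[OF _ sums_zero])
  qed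
  ultimately have "holo_ext c r (\<lambda>t. Re (F (of_real t)))"
    unfolding holo_ext_def by blast
  moreover have "Re (F (of_real t)) = df 0 t" if t: "t \<in> J \<inter> ball c r" for t
  proof -
    define x where "x = \<bar>t - c\<bar>"
    have x: "R * x < 1" "x \<ge> 0"
      using geo[of x] t by (auto simp: x_def dist_real_def abs_minus_commute)
    have rem: "\<bar>df 0 t - (\<Sum>k<n. a k * (t - c) ^ k)\<bar> \<le> A * (R * x) ^ n" if "n > 0" for n
    proof (cases "t = c")
      case True
      then have "(\<Sum>k<n. a k * (t - c) ^ k) = a 0"
        using \<open>n > 0\<close> by (cases n) (simp_all add: lessThan_Suc_eq_insert_0 sum.insert_if)
      then show ?thesis using True A x \<open>0 < R\<close> by (simp add: a_def)
    next
      case False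
      have seg: "\<forall>m s. m < n \<and> min c t \<le> s \<and> s \<le> max c t \<longrightarrow>
          DERIV (df m) s :> df (Suc m) s"
        using J t der unfolding is_interval_1 by (metis Int_iff max_def min_def)
      obtain s where s: "if t < c then t < s \<and> s < c else c < s \<and> s < t"
        and eq: "df 0 t = (\<Sum>k<n. df k c / fact k * (t - c) ^ k) + df n s / fact n * (t - c) ^ n"
        using Taylor[OF \<open>n > 0\<close> refl seg, of c t] False by fastforce
      have "s \<in> J" using s J t unfolding is_interval_1
        by (metis Int_iff less_eq_real_def)
      have "\<bar>df n s / fact n\<bar> * x ^ n \<le> (A * R ^ n) * x ^ n"
        using bd[OF \<open>s \<in> J\<close>, of n] x by (intro mult_right_mono) (auto simp: field_simps)
      then show ?thesis unfolding eq a_def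
        by (simp add: abs_mult x_def power_abs power_mult_distrib mult_ac)
    qed
    have "(\<lambda>n. A * (R * x) ^ n) \<longlonglongrightarrow> A * 0"
      using x \<open>0 < R\<close> by (intro tendsto_mult tendsto_const LIMSEQ_realpow_zero) auto
    then have lim0: "(\<lambda>n. A * (R * x) ^ n) \<longlonglongrightarrow> 0" by simp
    have "(\<lambda>n. df 0 t - (\<Sum>k<n. a k * (t - c) ^ k)) \<longlonglongrightarrow> 0"
      by (rule Lim_null_comparison[OF _ lim0])
        (use rem in \<open>auto intro!: eventually_sequentiallyI[of 1]\<close>)
    from tendsto_diff[OF tendsto_const[of "df 0 t"] this]
    have "(\<lambda>k. a k * (t - c) ^ k) sums df 0 t"
      by (simp add: sums_def)
    moreover have "(\<lambda>k. a k * (t - c) ^ k) sums Re (F (of_real t))"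
      using real_sums(1) t by blast
    ultimately show ?thesis by (rule sums_unique2[rotated])
  qed
  ultimately show ?thesis by blast
qed

text \<open>
  The radius of convergence is at least \<open>1 / R\<close> at every centre, so a centre closer than that to the
  endpoint \<open>b\<close> gives a Taylor series that converges beyond \<open>b\<close>.
\<close>
lemma polynomial_ode_extension:
  fixes a b :: real
  assumes "a < b" and fin: "finite G"
    and der: "\<And>g. g \<in> G \<Longrightarrow> \<exists>g'\<in>polys G. \<forall>t\<in>{a<..<b}. (g has_real_derivative g' t) (at t)"
    and bd: "\<And>g. g \<in> G \<Longrightarrow> \<exists>M. \<forall>t\<in>{a<..<b}. \<bar>g t\<bar> \<le> M"
  shows "\<exists>c r H. a \<le> c - r \<and> c - r < b \<and> b < c + r \<and>
    (\<forall>g\<in>G. holo_ext c r (H g) \<and> (\<forall>t\<in>{c - r<..<b}. H g t = g t))"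
proof -
  obtain A R where R: "0 < R" and df:
    "\<And>g. g \<in> G \<Longrightarrow> \<exists>df. df 0 = g \<and> (\<forall>k. \<forall>t\<in>{a<..<b}.
       (df k has_real_derivative df (Suc k) t) (at t) \<and> \<bar>df k t\<bar> \<le> A * fact k * R ^ k)"
    using polys_derivs_bound[OF fin der bd] by blast
  \<comment> \<open>The second bound on \<open>r\<close> keeps the left half of the disc inside the interval on which the
    functions are given.\<close>
  define r where "r = min (1 / R) ((b - a) / 2)"
  define c where "c = b - r / 2"
  have r: "0 < r" "r \<le> 1 / R" "r \<le> (b - a) / 2"
    using R \<open>a < b\<close> unfolding r_def by (simp, metis min.cobounded1, metis min.cobounded2)
  have ac: "a < c - r" "c < b" "b < c + r" using r \<open>a < b\<close> by (auto simp: c_def field_simps)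
  have "\<exists>h. holo_ext c r h \<and> (\<forall>t \<in> {a<..<b} \<inter> ball c r. h t = g t)" if g: "g \<in> G" for g
  proof -
    obtain df where d: "df 0 = g" "\<forall>k. \<forall>t\<in>{a<..<b}.
       (df k has_real_derivative df (Suc k) t) (at t) \<and> \<bar>df k t\<bar> \<le> A * fact k * R ^ k"
      using df[OF g] by blast
    have "c \<in> {a<..<b}" using ac r(1) by auto
    from taylor_holo_ext[OF R r(2) is_interval_oo this, of df A] d(2)
    show ?thesis unfolding d(1) by blast
  qed
  then obtain H where H: "\<And>g. g \<in> G \<Longrightarrow> holo_ext c r (H g)"
    "\<And>g t. g \<in> G \<Longrightarrow> t \<in> {a<..<b} \<inter> ball c r \<Longrightarrow> H g t = g t"
    by metis
  have "H g t = g t" if "g \<in> G" "t \<in> {c - r<..<b}" for g t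
    using H(2)[OF that(1)] that(2) ac by (auto simp: dist_real_def abs_less_iff)
  with ac H(1) have "a \<le> c - r \<and> c - r < b \<and> b < c + r \<and>
      (\<forall>g\<in>G. holo_ext c r (H g) \<and> (\<forall>t\<in>{c - r<..<b}. H g t = g t))" by auto
  then show ?thesis by blast
qed

section \<open>Geometry of the surface of constant curvature\<close>

lemma sig_simps: "sig \<kappa> * sig \<kappa> = 1" "(sig \<kappa>)\<^sup>2 = 1" "\<kappa> \<noteq> 0 \<Longrightarrow> sig \<kappa> * \<kappa> = \<bar>\<kappa>\<bar>" "\<bar>sig \<kappa>\<bar> = 1"
  by (auto simp: sig_def)

lemma odot_commute: "odot \<kappa> a b = odot \<kappa> b a"
  by (simp add: odot_def algebra_simps)

lemma odot_linear:
  "odot \<kappa> (a + b) c = odot \<kappa> a c + odot \<kappa> b c"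
  "odot \<kappa> (a - b) c = odot \<kappa> a c - odot \<kappa> b c"
  "odot \<kappa> (x *\<^sub>R a) c = x * odot \<kappa> a c"
  "odot \<kappa> c (a + b) = odot \<kappa> c a + odot \<kappa> c b"
  "odot \<kappa> c (a - b) = odot \<kappa> c a - odot \<kappa> c b"
  "odot \<kappa> c (x *\<^sub>R a) = x * odot \<kappa> c a"
  "odot \<kappa> 0 c = 0" "odot \<kappa> c 0 = 0"
  by (simp_all add: odot_def algebra_simps)

lemma odot_sum_right: "odot \<kappa> c (\<Sum>j\<in>A. f j) = (\<Sum>j\<in>A. odot \<kappa> c (f j))"
  by (induction A rule: infinite_finite_induct) (simp_all add: odot_linear)

lemma M2_odot: "q \<in> M2 \<kappa> \<Longrightarrow> \<kappa> * odot \<kappa> q q = 1"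
  by (simp add: M2_def odot_def power2_eq_square mult_ac)

text \<open>
  On the hyperboloid the ambient form is Lorentzian, but its restriction to a tangent plane is
  positive. This is what makes kinetic energy control the velocities, and it allows the sphere and
  the hyperbolic plane to be treated together from here on. For \<open>\<kappa> < 0\<close> the third component of \<open>u\<close>
  is determined by the other two through tangency, and the Cauchy-Schwarz inequality in the
  horizontal plane bounds it, as \<open>q\<close> is timelike.
\<close>
lemma odot_tangent_nonneg:
  assumes q: "\<kappa> * odot \<kappa> q q = 1" and u: "odot \<kappa> q u = 0"
  shows "odot \<kappa> u u \<ge> 0"
proof (cases "\<kappa> > 0")
  case True
  then show ?thesis by (simp add: odot_def sig_def)
next
  case False
  have \<kappa>: "\<kappa> < 0" using False q by (cases "\<kappa> = 0") auto
  define r where "r = (q$1)\<^sup>2 + (q$2)\<^sup>2"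
  define v where "v = (u$1)\<^sup>2 + (u$2)\<^sup>2"
  have "\<kappa> * (r - (q$3)\<^sup>2) = 1" using q False by (simp add: odot_def sig_def r_def power2_eq_square)
  then have "r - (q$3)\<^sup>2 < 0" using \<kappa> by (metis mult_nonpos_nonneg not_less less_eq_real_def zero_less_one less_le_trans not_one_le_zero)
  then have z: "r < (q$3)\<^sup>2" by simp
  have r0: "r \<ge> 0" "v \<ge> 0" by (simp_all add: r_def v_def)
  have "q$3 * u$3 = q$1 * u$1 + q$2 * u$2" using u False by (simp add: odot_def sig_def)
  then have "(q$3)\<^sup>2 * (u$3)\<^sup>2 = (q$1 * u$1 + q$2 * u$2)\<^sup>2" by (simp flip: power_mult_distrib)
  also have "\<dots> = r * v - (q$1 * u$2 - q$2 * u$1)\<^sup>2"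
    by (simp add: r_def v_def power2_eq_square algebra_simps)
  also have "\<dots> \<le> r * v" by simp
  also have "\<dots> \<le> (q$3)\<^sup>2 * v" using z r0 by (intro mult_right_mono) auto
  finally have "(u$3)\<^sup>2 \<le> v" using z r0 by (auto simp: mult_le_cancel_left)
  then show ?thesis using False by (simp add: odot_def sig_def v_def power2_eq_square)
qed

text \<open>
  The form is known to be positive semidefinite on the tangent plane, so the discriminant argument
  applies; a vector \<open>v\<close> of norm zero needs a separate choice of the parameter.
\<close>
lemma odot_tangent_Cauchy_Schwarz:
  assumes q: "\<kappa> * odot \<kappa> q q = 1" and u: "odot \<kappa> q u = 0" and v: "odot \<kappa> q v = 0"
  shows "(odot \<kappa> u v)\<^sup>2 \<le> odot \<kappa> u u * odot \<kappa> v v"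
proof -
  have quad: "0 \<le> odot \<kappa> u u + 2 * l * odot \<kappa> u v + l\<^sup>2 * odot \<kappa> v v" for l
    using odot_tangent_nonneg[OF q, of "u + l *\<^sub>R v"] u v
    by (simp add: odot_linear odot_commute[of _ v u] power2_eq_square algebra_simps)
  have v0: "odot \<kappa> v v \<ge> 0" using odot_tangent_nonneg[OF q v] .
  show ?thesis
  proof (cases "odot \<kappa> v v = 0")
    case True
    have "odot \<kappa> u v = 0"
    proof (rule ccontr)
      assume nz: "odot \<kappa> u v \<noteq> 0"
      show False using quad[of "- (odot \<kappa> u u + 1) / (2 * odot \<kappa> u v)"] True nz
        by (simp add: field_simps)
    qed
    then show ?thesis using True by simp
  next
    case False
    have "0 \<le> odot \<kappa> v v * (odot \<kappa> u u + 2 * (- odot \<kappa> u v / odot \<kappa> v v) * odot \<kappa> u v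
        + (- odot \<kappa> u v / odot \<kappa> v v)\<^sup>2 * odot \<kappa> v v)"
      using quad v0 by (rule mult_nonneg_nonneg[rotated])
    also have "\<dots> = odot \<kappa> u u * odot \<kappa> v v - (odot \<kappa> u v)\<^sup>2"
      using False by (simp add: field_simps power2_eq_square)
    finally show ?thesis by simp
  qed
qed

text \<open>
  With \<open>d\<close> the geodesic distance of \<open>a\<close> and \<open>b\<close>, this is \<open>sin\<^sup>2 (sqrt \<kappa> d)\<close> on the sphere and
  \<open>sinh\<^sup>2 (sqrt \<bar>\<kappa>\<bar> d)\<close> on the hyperbolic plane. The factor \<open>\<sigma>\<close> makes it nonnegative in both cases,
  and it vanishes exactly at the singular pairs.
\<close>
definition gap :: "real \<Rightarrow> real ^ 3 \<Rightarrow> real ^ 3 \<Rightarrow> real" where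
  "gap \<kappa> a b = sig \<kappa> * (1 - (\<kappa> * odot \<kappa> a b)\<^sup>2)"

lemma gap_commute: "gap \<kappa> a b = gap \<kappa> b a"
  by (simp add: gap_def odot_commute)

lemma gap_eq_0_iff: "gap \<kappa> a b = 0 \<longleftrightarrow> (\<kappa> * odot \<kappa> a b)\<^sup>2 = 1"
  by (auto simp: gap_def sig_def)

text \<open>
  The component of \<open>a\<close> in the tangent plane at \<open>q\<close>. Through it, products of a tangent vector with an
  arbitrary vector of the ambient space come under the Cauchy-Schwarz inequality.
\<close>
lemma odot_rejection:
  assumes q: "\<kappa> * odot \<kappa> q q = 1"
  defines "u \<equiv> \<lambda>a. a - (\<kappa> * odot \<kappa> q a) *\<^sub>R q"
  shows "odot \<kappa> q (u a) = 0"
    and "odot \<kappa> (u a) (u a) = odot \<kappa> a a - \<kappa> * (odot \<kappa> q a)\<^sup>2"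
    and "odot \<kappa> q v = 0 \<Longrightarrow> odot \<kappa> v (u a) = odot \<kappa> v a"
proof -
  have qq: "\<kappa> * (odot \<kappa> q q * x) = x" for x using q by (simp flip: mult.assoc)
  show "odot \<kappa> q (u a) = 0"
    using qq[of "odot \<kappa> q a"] by (simp add: u_def odot_linear mult_ac)
  show "odot \<kappa> (u a) (u a) = odot \<kappa> a a - \<kappa> * (odot \<kappa> q a)\<^sup>2"
    using qq[of "\<kappa> * (odot \<kappa> q a)\<^sup>2"]
    by (simp add: u_def odot_linear odot_commute[of _ a q] power2_eq_square algebra_simps)
  show "odot \<kappa> v (u a) = odot \<kappa> v a" if "odot \<kappa> q v = 0"
    using that by (simp add: u_def odot_linear odot_commute[of _ v q])
qed

lemma odot_tangent_bound:
  assumes q: "\<kappa> * odot \<kappa> q q = 1" and v: "odot \<kappa> q v = 0"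
  shows "(odot \<kappa> v a)\<^sup>2 \<le> odot \<kappa> v v * (odot \<kappa> a a - \<kappa> * (odot \<kappa> q a)\<^sup>2)"
  using odot_tangent_Cauchy_Schwarz[OF q v odot_rejection(1)[OF q, of a]]
  by (simp add: odot_rejection(2)[OF q] odot_rejection(3)[OF q v])

text \<open>
  Up to the factor \<open>\<bar>\<kappa>\<bar>\<close>, the gap is the squared norm of the tangential component of \<open>b\<close> at \<open>a\<close>.
\<close>
lemma gap_eq_rejection:
  assumes "\<kappa> * odot \<kappa> b b = 1"
  shows "gap \<kappa> a b = \<bar>\<kappa>\<bar> * (odot \<kappa> b b - \<kappa> * (odot \<kappa> a b)\<^sup>2)"
proof -
  have "\<kappa> \<noteq> 0" using assms by auto
  have "\<bar>\<kappa>\<bar> * (odot \<kappa> b b - \<kappa> * (odot \<kappa> a b)\<^sup>2) = sig \<kappa> * (\<kappa> * odot \<kappa> b b - (\<kappa> * odot \<kappa> a b)\<^sup>2)"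
    by (simp add: sig_simps(3)[OF \<open>\<kappa> \<noteq> 0\<close>, symmetric] power2_eq_square algebra_simps)
  then show ?thesis by (simp add: gap_def assms)
qed

lemma gap_nonneg:
  assumes "\<kappa> * odot \<kappa> a a = 1" "\<kappa> * odot \<kappa> b b = 1"
  shows "gap \<kappa> a b \<ge> 0"
  using odot_tangent_nonneg[OF assms(1) odot_rejection(1)[OF assms(1)], of b]
  by (simp add: gap_eq_rejection[OF assms(2)] odot_rejection(2)[OF assms(1)])

lemma gap_eq_abs:
  assumes "\<kappa> * odot \<kappa> a a = 1" "\<kappa> * odot \<kappa> b b = 1"
  shows "gap \<kappa> a b = \<bar>(\<kappa> * odot \<kappa> a b)\<^sup>2 - 1\<bar>"
  using gap_nonneg[OF assms] by (auto simp: gap_def sig_def split: if_splits)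

text \<open>
  The left-hand side is the squared rate at which \<open>\<kappa> a \<odot> b\<close> changes when \<open>a\<close> moves with velocity \<open>v\<close>.
  Besides the speed, the bound involves the two points only through their gap, not through their
  positions on the possibly unbounded surface.
\<close>
lemma odot_tangent_gap:
  assumes "\<kappa> * odot \<kappa> a a = 1" "\<kappa> * odot \<kappa> b b = 1" "odot \<kappa> a v = 0"
  shows "(\<kappa> * odot \<kappa> v b)\<^sup>2 \<le> \<bar>\<kappa>\<bar> * odot \<kappa> v v * gap \<kappa> a b"
proof -
  have "(\<kappa> * odot \<kappa> v b)\<^sup>2 \<le> \<kappa>\<^sup>2 * (odot \<kappa> v v * (odot \<kappa> b b - \<kappa> * (odot \<kappa> a b)\<^sup>2))"
    unfolding power_mult_distrib
    by (intro mult_left_mono odot_tangent_bound[OF assms(1,3)]) auto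
  moreover have "\<kappa>\<^sup>2 = \<bar>\<kappa>\<bar> * \<bar>\<kappa>\<bar>" by (simp add: power2_eq_square)
  ultimately show ?thesis by (simp add: gap_eq_rejection[OF assms(2)] mult_ac)
qed

lemma odot_le_sqrt_gap:
  assumes "0 \<le> gap \<kappa> a b"
  shows "\<bar>\<kappa> * odot \<kappa> a b\<bar> \<le> sqrt (1 + gap \<kappa> a b)"
proof (rule real_le_rsqrt)
  show "\<bar>\<kappa> * odot \<kappa> a b\<bar>\<^sup>2 \<le> 1 + gap \<kappa> a b"
    using assms by (cases "\<kappa> > 0") (auto simp: gap_def sig_def)
qed

lemma odot_has_real_derivative:
  assumes "(f has_vector_derivative f') (at t within S)" "(g has_vector_derivative g') (at t within S)"
  shows "((\<lambda>s. odot \<kappa> (f s) (g s)) has_real_derivative odot \<kappa> f' (g t) + odot \<kappa> (f t) g') (at t within S)"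
proof -
  have c: "((\<lambda>s. h s $ k) has_real_derivative h' $ k) (at t within S)"
    if "(h has_vector_derivative h') (at t within S)" for h :: "real \<Rightarrow> real ^ 3" and h' k
    using bounded_linear.has_vector_derivative[OF bounded_linear_vec_nth that]
    by (simp add: has_real_derivative_iff_has_vector_derivative)
  have "((\<lambda>s. odot \<kappa> (f s) (g s)) has_real_derivative
      (f' $ 1 * g t $ 1 + g' $ 1 * f t $ 1) + (f' $ 2 * g t $ 2 + g' $ 2 * f t $ 2)
      + (sig \<kappa> * f' $ 3 * g t $ 3 + g' $ 3 * (sig \<kappa> * f t $ 3))) (at t within S)"
    unfolding odot_def by (intro DERIV_add DERIV_mult DERIV_cmult c assms)
  then show ?thesis by (rule DERIV_cong) (simp add: odot_def algebra_simps)
qed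

lemma gap_has_real_derivative:
  assumes "(f has_vector_derivative f') (at t within S)" "(g has_vector_derivative g') (at t within S)"
  shows "((\<lambda>s. gap \<kappa> (f s) (g s)) has_real_derivative
     - 2 * sig \<kappa> * (\<kappa> * odot \<kappa> (f t) (g t)) * (\<kappa> * (odot \<kappa> f' (g t) + odot \<kappa> (f t) g'))) (at t within S)"
proof -
  have "((\<lambda>s. gap \<kappa> (f s) (g s)) has_real_derivative sig \<kappa> * (0 - of_nat 2 *
      (\<kappa> * (odot \<kappa> f' (g t) + odot \<kappa> (f t) g') * (\<kappa> * odot \<kappa> (f t) (g t)) ^ (2 - Suc 0)))) (at t within S)"
    unfolding gap_def
    by (intro DERIV_cmult DERIV_diff DERIV_const DERIV_power odot_has_real_derivative assms)
  then show ?thesis by (rule DERIV_cong) simp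
qed

text \<open>
  Writing \<open>G\<close> for the gap and \<open>c\<close> for \<open>\<kappa> f \<odot> g\<close>, the derivative of \<open>G\<close> is \<open>- 2 \<sigma> c c'\<close>, where
  \<open>\<bar>c\<bar> \<le> sqrt (1 + G)\<close> and \<open>\<bar>c'\<bar> \<le> 2 sqrt \<bar>\<kappa>\<bar> V sqrt G\<close>. Dividing by \<open>1 + G\<close> leaves a bound without
  \<open>G\<close>. The gap itself would not do: on the hyperbolic plane it grows exponentially with the distance.
\<close>
lemma ln_gap_lipschitz:
  fixes f g :: "real \<Rightarrow> real ^ 3"
  assumes "x \<le> y" "0 \<le> V"
    and f: "\<And>t. t \<in> {x..y} \<Longrightarrow> (f has_vector_derivative f' t) (at t within {x..y})"
      "\<And>t. t \<in> {x..y} \<Longrightarrow> \<kappa> * odot \<kappa> (f t) (f t) = 1"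
      "\<And>t. t \<in> {x..y} \<Longrightarrow> odot \<kappa> (f t) (f' t) = 0"
      "\<And>t. t \<in> {x..y} \<Longrightarrow> odot \<kappa> (f' t) (f' t) \<le> V\<^sup>2"
    and g: "\<And>t. t \<in> {x..y} \<Longrightarrow> (g has_vector_derivative g' t) (at t within {x..y})"
      "\<And>t. t \<in> {x..y} \<Longrightarrow> \<kappa> * odot \<kappa> (g t) (g t) = 1"
      "\<And>t. t \<in> {x..y} \<Longrightarrow> odot \<kappa> (g t) (g' t) = 0"
      "\<And>t. t \<in> {x..y} \<Longrightarrow> odot \<kappa> (g' t) (g' t) \<le> V\<^sup>2"
  shows "\<bar>ln (1 + gap \<kappa> (f y) (g y)) - ln (1 + gap \<kappa> (f x) (g x))\<bar> \<le> 4 * sqrt \<bar>\<kappa>\<bar> * V * (y - x)"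
proof -
  define D where "D t = - 2 * sig \<kappa> * (\<kappa> * odot \<kappa> (f t) (g t)) *
    (\<kappa> * (odot \<kappa> (f' t) (g t) + odot \<kappa> (f t) (g' t)))" for t
  have nn: "0 \<le> gap \<kappa> (f t) (g t)" if "t \<in> {x..y}" for t
    using gap_nonneg f(2) g(2) that by blast
  have "norm (ln (1 + gap \<kappa> (f y) (g y)) - ln (1 + gap \<kappa> (f x) (g x))) \<le> 4 * sqrt \<bar>\<kappa>\<bar> * V * norm (y - x)"
  proof (rule field_differentiable_bound[of "{x..y}"])
    fix t assume t: "t \<in> {x..y}"
    define G where "G = gap \<kappa> (f t) (g t)"
    have G: "0 \<le> G" using nn[OF t] by (simp add: G_def)
    show "((\<lambda>t. ln (1 + gap \<kappa> (f t) (g t))) has_field_derivative D t / (1 + G)) (at t within {x..y})"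
      using DERIV_chain2[OF DERIV_ln_divide
          DERIV_add[OF DERIV_const[of 1] gap_has_real_derivative[OF f(1)[OF t] g(1)[OF t], of \<kappa>]]] nn[OF t]
      by (simp add: D_def G_def)
    have speed: "\<bar>\<kappa> * odot \<kappa> v b\<bar> \<le> sqrt \<bar>\<kappa>\<bar> * V * sqrt (1 + G)"
      if "\<kappa> * odot \<kappa> a a = 1" "\<kappa> * odot \<kappa> b b = 1" "odot \<kappa> a v = 0" "odot \<kappa> v v \<le> V\<^sup>2" "gap \<kappa> a b = G" for a b v
    proof -
      have "(\<kappa> * odot \<kappa> v b)\<^sup>2 \<le> \<bar>\<kappa>\<bar> * odot \<kappa> v v * G"
        using odot_tangent_gap[OF that(1-3)] that(5) by simp
      also have "\<dots> \<le> \<bar>\<kappa>\<bar> * V\<^sup>2 * (1 + G)"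
        using that(4) G by (intro mult_mono mult_left_mono) auto
      finally have "\<bar>\<kappa> * odot \<kappa> v b\<bar> \<le> sqrt (\<bar>\<kappa>\<bar> * V\<^sup>2 * (1 + G))"
        by (intro real_le_rsqrt) simp
      then show ?thesis using \<open>0 \<le> V\<close> by (simp add: real_sqrt_mult)
    qed
    have "\<bar>\<kappa> * (odot \<kappa> (f' t) (g t) + odot \<kappa> (f t) (g' t))\<bar> \<le> 2 * (sqrt \<bar>\<kappa>\<bar> * V * sqrt (1 + G))"
      using speed[OF f(2)[OF t] g(2)[OF t] f(3)[OF t] f(4)[OF t]]
        speed[OF g(2)[OF t] f(2)[OF t] g(3)[OF t] g(4)[OF t]]
      by (simp add: G_def gap_commute odot_commute[of \<kappa> "g' t"] distrib_left)
    moreover have "\<bar>\<kappa> * odot \<kappa> (f t) (g t)\<bar> \<le> sqrt (1 + G)"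
      unfolding G_def by (rule odot_le_sqrt_gap[OF nn[OF t]])
    ultimately have "2 * (\<bar>\<kappa> * odot \<kappa> (f t) (g t)\<bar> * \<bar>\<kappa> * (odot \<kappa> (f' t) (g t) + odot \<kappa> (f t) (g' t))\<bar>)
      \<le> 2 * (sqrt (1 + G) * (2 * (sqrt \<bar>\<kappa>\<bar> * V * sqrt (1 + G))))"
      by (intro mult_left_mono mult_mono) (use G in auto)
    also have "\<dots> = 4 * sqrt \<bar>\<kappa>\<bar> * V * (1 + G)" using G by (simp add: real_sqrt_mult_self)
    finally have "\<bar>D t\<bar> \<le> 4 * sqrt \<bar>\<kappa>\<bar> * V * (1 + G)"
      by (simp add: D_def abs_mult sig_simps mult_ac)
    then show "norm (D t / (1 + G)) \<le> 4 * sqrt \<bar>\<kappa>\<bar> * V"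
      using G by (simp add: field_simps)
  qed (use \<open>x \<le> y\<close> in auto)
  then show ?thesis using \<open>x \<le> y\<close> by simp
qed

section \<open>The force and a continuation argument\<close>

lemma sum_offdiag_swap:
  "(\<Sum>i\<in>A. \<Sum>j\<in>A - {i}. T j i) = (\<Sum>i\<in>A. \<Sum>j\<in>A - {i}. T i j)" if "finite A" for T :: "'a \<Rightarrow> 'a \<Rightarrow> real"
proof -
  have s: "A - {i} = {j \<in> A. i \<noteq> j}" "A - {i} = {j \<in> A. j \<noteq> i}" for i by auto
  have "(\<Sum>i\<in>A. \<Sum>j\<in>{j \<in> A. i \<noteq> j}. T j i) = (\<Sum>j\<in>A. \<Sum>i\<in>{i \<in> A. i \<noteq> j}. T j i)"
    by (rule sum.swap_restrict[OF that that])
  then show ?thesis by (simp only: s(1)[symmetric] s(2)[symmetric])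
qed

text \<open>
  On the constraint surface, and with \<open>w = 1 / sqrt gap\<close>, the force is a polynomial in positions and
  \<open>w\<close>. The relation \<open>w\<^sup>2 gap = 1\<close> is assumed in place of a definition of \<open>w\<close>, so that the formula
  also applies to the analytic extensions of these functions.
\<close>
lemma grad_U_eq:
  assumes "\<And>i. i \<in> {1..n} \<Longrightarrow> \<kappa> * odot \<kappa> (q i) (q i) = 1" and i: "i \<in> {1..n}"
    and w: "\<And>j. j \<in> {1..n} - {i} \<Longrightarrow> 0 < w j \<and> (w j)\<^sup>2 * gap \<kappa> (q i) (q j) = 1"
  shows "grad_U \<kappa> n m q i = (\<Sum>j\<in>{1..n} - {i}.
     (m i * m j * \<bar>\<kappa>\<bar> powr (3/2) * w j ^ 3) *\<^sub>R (q j - (\<kappa> * odot \<kappa> (q i) (q j)) *\<^sub>R q i))"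
  unfolding grad_U_def
proof (rule sum.cong[OF refl])
  fix j assume j: "j \<in> {1..n} - {i}"
  define g where "g = gap \<kappa> (q i) (q j)"
  have qq: "\<kappa> * odot \<kappa> (q i) (q i) = 1" "\<kappa> * odot \<kappa> (q j) (q j) = 1" using assms(1) i j by auto
  have "\<kappa> \<noteq> 0" using qq by auto
  have W: "0 < w j" "(w j)\<^sup>2 * g = 1" using w[OF j] by (auto simp: g_def)
  define u where "u = inverse (w j)"
  have "0 < u" using W(1) by (simp add: u_def)
  have "g = u\<^sup>2" using W by (simp add: u_def power_inverse inverse_unique[of "(w j)\<^sup>2" g])
  also have "\<dots> = u powr 2" using \<open>0 < u\<close> by (simp add: powr_numeral)
  finally have "g powr (3/2) = u powr 3" by (simp add: powr_powr)
  then have gp: "g powr (3/2) = inverse (w j ^ 3)"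
    using \<open>0 < u\<close> by (simp add: powr_numeral u_def power_inverse)
  have den: "sig \<kappa> * (\<kappa> * odot \<kappa> (q i) (q i)) * (\<kappa> * odot \<kappa> (q j) (q j)) - sig \<kappa> * (\<kappa> * odot \<kappa> (q i) (q j))\<^sup>2 = g"
    unfolding qq g_def gap_def right_diff_distrib mult_1_right ..
  show "(m i * m j * (sig \<kappa> * \<kappa>) powr (3/2) * (\<kappa> * odot \<kappa> (q j) (q j))
          / (sig \<kappa> * (\<kappa> * odot \<kappa> (q i) (q i)) * (\<kappa> * odot \<kappa> (q j) (q j))
              - sig \<kappa> * (\<kappa> * odot \<kappa> (q i) (q j))\<^sup>2) powr (3/2))
        *\<^sub>R ((\<kappa> * odot \<kappa> (q i) (q i)) *\<^sub>R q j - (\<kappa> * odot \<kappa> (q i) (q j)) *\<^sub>R q i) =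
     (m i * m j * \<bar>\<kappa>\<bar> powr (3/2) * w j ^ 3) *\<^sub>R (q j - (\<kappa> * odot \<kappa> (q i) (q j)) *\<^sub>R q i)"
    unfolding den gp unfolding qq sig_simps(3)[OF \<open>\<kappa> \<noteq> 0\<close>] 
    by (simp only: mult_1_right divide_inverse inverse_inverse_eq scaleR_one)
qed

text \<open>
  Otherwise there is a first time \<open>T\<close> at which one of the bounds fails; before \<open>T\<close> all of them hold, so
  \<open>step\<close> gives them at \<open>T\<close> as well.
\<close>
lemma bootstrap_lower_bound:
  fixes f :: "'i \<Rightarrow> real \<Rightarrow> real"
  assumes "finite I" and cont: "\<And>i. i \<in> I \<Longrightarrow> continuous_on {a..<b} (f i)"
    and step: "\<And>T i. a \<le> T \<Longrightarrow> T < b \<Longrightarrow> (\<And>t i. a \<le> t \<Longrightarrow> t < T \<Longrightarrow> i \<in> I \<Longrightarrow> e < f i t) \<Longrightarrow> i \<in> I \<Longrightarrow> e < f i T"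
    and t: "t \<in> {a..<b}" "i \<in> I"
  shows "e < f i t"
proof (rule ccontr)
  assume bad: "\<not> e < f i t"
  define S where "S = (\<Union>i\<in>I. {s \<in> {a..t}. f i s \<le> e})"
  have "closed {s \<in> {a..t}. f i s \<le> e}" if "i \<in> I" for i
  proof -
    have "continuous_on {a..t} (f i)"
      by (rule continuous_on_subset[OF cont[OF that]]) (use t in auto)
    from continuous_closed_preimage[OF this closed_atLeastAtMost closed_atMost[of e]]
    show ?thesis by (simp add: vimage_def Int_def)
  qed
  then have "closed S" unfolding S_def using \<open>finite I\<close> by (intro closed_UN) auto
  moreover have "S \<subseteq> {a..t}" by (auto simp: S_def)
  ultimately have "compact S"
    by (metis bounded_closed_interval bounded_subset compact_eq_bounded_closed)
  moreover have "t \<in> S" unfolding S_def by (rule UN_I[OF t(2)]) (use bad t in auto)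
  ultimately obtain T where T: "T \<in> S" "\<And>s. s \<in> S \<Longrightarrow> T \<le> s"
    using compact_attains_inf[of S] by auto
  obtain k where k: "k \<in> I" "f k T \<le> e" "T \<in> {a..t}" using T(1) by (auto simp: S_def)
  have "e < f k T"
  proof (rule step)
    show "e < f i s" if "a \<le> s" "s < T" "i \<in> I" for s i
      using T(2)[of s] that k(3) by (force simp: S_def)
  qed (use k t in auto)
  with k(2) show False by simp
qed

section \<open>Energy and persistence of separation\<close>

locale curved_motion =
  fixes \<kappa> :: real and n :: nat and m :: "nat \<Rightarrow> real" and ts :: real
    and q p :: "real \<Rightarrow> nat \<Rightarrow> real ^ 3"
  assumes \<kappa>: "\<kappa> \<noteq> 0" and m: "\<And>i. i \<in> {1..n} \<Longrightarrow> m i > 0" and ts: "0 < ts"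
    and sol: "solution_on \<kappa> n m {0..<ts} q p"
begin

definition vel :: "real \<Rightarrow> nat \<Rightarrow> real ^ 3" where
  "vel t i = (1 / m i) *\<^sub>R p t i"

text \<open>
  On the sphere this is the cosine of the angle between the two bodies, on the hyperbolic plane the
  hyperbolic cosine of their rescaled distance; \<open>separation\<close> and \<open>cosec\<close> are the corresponding
  squared sine and reciprocal sine.
\<close>
definition cosine :: "real \<Rightarrow> nat \<Rightarrow> nat \<Rightarrow> real" where
  "cosine t i j = \<kappa> * odot \<kappa> (q t i) (q t j)"

definition separation :: "real \<Rightarrow> nat \<Rightarrow> nat \<Rightarrow> real" where
  "separation t i j = gap \<kappa> (q t i) (q t j)"

definition cosec :: "real \<Rightarrow> nat \<Rightarrow> nat \<Rightarrow> real" where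
  "cosec t i j = 1 / sqrt (separation t i j)"

lemma in_M2: "t \<in> {0..<ts} \<Longrightarrow> i \<in> {1..n} \<Longrightarrow> q t i \<in> M2 \<kappa>"
  using sol by (auto simp: solution_on_def)

lemma on_surface: "t \<in> {0..<ts} \<Longrightarrow> i \<in> {1..n} \<Longrightarrow> \<kappa> * odot \<kappa> (q t i) (q t i) = 1"
  by (rule M2_odot[OF in_M2])

lemma tangent: "t \<in> {0..<ts} \<Longrightarrow> i \<in> {1..n} \<Longrightarrow> odot \<kappa> (q t i) (p t i) = 0"
  using sol by (auto simp: solution_on_def)

lemma vel_tangent: "t \<in> {0..<ts} \<Longrightarrow> i \<in> {1..n} \<Longrightarrow> odot \<kappa> (q t i) (vel t i) = 0"
  by (simp add: vel_def odot_linear tangent)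

lemma separation_pos:
  assumes "t \<in> {0..<ts}" "i \<in> {1..n}" "j \<in> {1..n}" "i \<noteq> j"
  shows "0 < separation t i j"
proof -
  have "q t \<notin> singular_set \<kappa> n" using sol assms(1) by (auto simp: solution_on_def)
  then have "(\<kappa> * odot \<kappa> (q t i) (q t j))\<^sup>2 \<noteq> 1"
    using assms by (cases "i < j") (auto simp: singular_set_def odot_commute[of \<kappa> "q t i"])
  then have "separation t i j \<noteq> 0" by (simp add: separation_def gap_eq_0_iff)
  moreover have "0 \<le> separation t i j"
    unfolding separation_def using assms by (intro gap_nonneg on_surface)
  ultimately show ?thesis by simp
qed

lemma cosec_pos:
  assumes "t \<in> {0..<ts}" "i \<in> {1..n}" "j \<in> {1..n}" "i \<noteq> j"
  shows "0 < cosec t i j" "(cosec t i j)\<^sup>2 * separation t i j = 1"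
  using separation_pos[OF assms] by (auto simp: cosec_def power_divide)

lemma force_eq:
  assumes "t \<in> {0..<ts}" "i \<in> {1..n}"
  shows "grad_U \<kappa> n m (q t) i = (\<Sum>j\<in>{1..n} - {i}.
     (m i * m j * \<bar>\<kappa>\<bar> powr (3/2) * cosec t i j ^ 3) *\<^sub>R (q t j - cosine t i j *\<^sub>R q t i))"
  unfolding cosine_def
  by (rule grad_U_eq) (use assms on_surface cosec_pos in \<open>auto simp: separation_def\<close>)

lemma at_interior: "t \<in> {0<..<ts} \<Longrightarrow> at t within {0..<ts} = at t"
  by (rule at_within_interior) (auto simp: interior_atLeastLessThan)

lemma q_deriv:
  assumes "t \<in> {0<..<ts}" "i \<in> {1..n}"
  shows "((\<lambda>s. q s i) has_vector_derivative vel t i) (at t)"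
proof -
  have "((\<lambda>s. q s i) has_vector_derivative vel t i) (at t within {0..<ts})"
    using sol assms by (auto simp: solution_on_def vel_def)
  then show ?thesis by (simp only: at_interior[OF assms(1)])
qed

definition accel :: "real \<Rightarrow> nat \<Rightarrow> real ^ 3" where
  "accel t i = grad_U \<kappa> n m (q t) i - ((1 / m i) * \<kappa> * odot \<kappa> (p t i) (p t i)) *\<^sub>R q t i"

lemma p_deriv:
  assumes "t \<in> {0<..<ts}" "i \<in> {1..n}"
  shows "((\<lambda>s. p s i) has_vector_derivative accel t i) (at t)"
proof -
  have "((\<lambda>s. p s i) has_vector_derivative accel t i) (at t within {0..<ts})"
    using sol assms by (auto simp: solution_on_def accel_def)
  then show ?thesis by (simp only: at_interior[OF assms(1)])
qed

lemma q_comp_deriv: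
  assumes "t \<in> {0<..<ts}" "i \<in> {1..n}"
  shows "((\<lambda>s. q s i $ k) has_real_derivative p t i $ k / m i) (at t)"
  using bounded_linear.has_vector_derivative[OF bounded_linear_vec_nth q_deriv[OF assms]]
  by (simp add: has_real_derivative_iff_has_vector_derivative vel_def)

lemma p_comp_deriv:
  assumes "t \<in> {0<..<ts}" "i \<in> {1..n}"
  shows "((\<lambda>s. p s i $ k) has_real_derivative
     (\<Sum>j\<in>{1..n} - {i}. m i * m j * \<bar>\<kappa>\<bar> powr (3/2) * cosec t i j ^ 3 * (q t j $ k - cosine t i j * q t i $ k))
      - (1 / m i) * \<kappa> * odot \<kappa> (p t i) (p t i) * q t i $ k) (at t)"
proof -
  have "accel t i $ k = (\<Sum>j\<in>{1..n} - {i}. m i * m j * \<bar>\<kappa>\<bar> powr (3/2) * cosec t i j ^ 3 * (q t j $ k - cosine t i j * q t i $ k))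
      - (1 / m i) * \<kappa> * odot \<kappa> (p t i) (p t i) * q t i $ k"
    using assms by (simp add: accel_def force_eq)
  with bounded_linear.has_vector_derivative[OF bounded_linear_vec_nth p_deriv[OF assms], of k]
  show ?thesis by (simp add: has_real_derivative_iff_has_vector_derivative)
qed

lemma cosine_deriv:
  assumes "t \<in> {0<..<ts}" "i \<in> {1..n}" "j \<in> {1..n}"
  shows "((\<lambda>s. cosine s i j) has_real_derivative
    \<kappa> * (odot \<kappa> (vel t i) (q t j) + odot \<kappa> (q t i) (vel t j))) (at t)"
  unfolding cosine_def using assms
  by (intro DERIV_cmult odot_has_real_derivative q_deriv)

lemma cosec_deriv:
  assumes "t \<in> {0<..<ts}" "i \<in> {1..n}" "j \<in> {1..n}" "i \<noteq> j"
  shows "((\<lambda>s. cosec s i j) has_real_derivative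
    sig \<kappa> * cosine t i j * (\<kappa> * (odot \<kappa> (vel t i) (q t j) + odot \<kappa> (q t i) (vel t j))) * cosec t i j ^ 3) (at t)"
proof -
  define D where "D = \<kappa> * (odot \<kappa> (vel t i) (q t j) + odot \<kappa> (q t i) (vel t j))"
  have pos: "0 < separation t i j" using separation_pos assms by auto
  have "((\<lambda>s. separation s i j) has_real_derivative - 2 * sig \<kappa> * cosine t i j * D) (at t)"
    unfolding separation_def cosine_def D_def using assms
    by (intro gap_has_real_derivative q_deriv)
  then have "((\<lambda>s. 1 / sqrt (separation s i j)) has_real_derivative
     - ((- 2 * sig \<kappa> * cosine t i j * D) * (inverse (sqrt (separation t i j)) / 2)) / (sqrt (separation t i j))\<^sup>2) (at t)"
    using pos by (auto intro!: derivative_eq_intros simp: power2_eq_square)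
  also have "- ((- 2 * sig \<kappa> * cosine t i j * D) * (inverse (sqrt (separation t i j)) / 2)) / (sqrt (separation t i j))\<^sup>2
     = sig \<kappa> * cosine t i j * D * cosec t i j ^ 3"
    using pos by (simp add: cosec_def field_simps power2_eq_square power3_eq_cube)
  finally show ?thesis by (simp add: cosec_def[abs_def] D_def)
qed

text \<open>
  The potential of a pair is proportional to \<open>c w\<close>, the cotangent of the distance. As
  \<open>w' = \<sigma> c c' w\<^sup>3\<close>, its derivative is \<open>c' (w + \<sigma> c\<^sup>2 w\<^sup>3)\<close>, and \<open>w = \<sigma> (1 - c\<^sup>2) w\<^sup>3\<close>
  reduces this to \<open>\<sigma> c' w\<^sup>3\<close>.
\<close>
lemma pair_potential_deriv:
  assumes "t \<in> {0<..<ts}" "i \<in> {1..n}" "j \<in> {1..n}" "i \<noteq> j"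
  shows "((\<lambda>s. cosine s i j * cosec s i j) has_real_derivative
    \<bar>\<kappa>\<bar> * (odot \<kappa> (vel t i) (q t j) + odot \<kappa> (vel t j) (q t i)) * cosec t i j ^ 3) (at t)"
proof -
  define D where "D = odot \<kappa> (vel t i) (q t j) + odot \<kappa> (q t i) (vel t j)"
  define c w where "c = cosine t i j" and "w = cosec t i j"
  have "w\<^sup>2 * (sig \<kappa> * (1 - c\<^sup>2)) = 1"
    using cosec_pos(2)[of t i j] assms by (simp add: c_def w_def cosine_def separation_def gap_def)
  then have w: "sig \<kappa> * (w\<^sup>2 * (sig \<kappa> * (1 - c\<^sup>2))) = sig \<kappa>" by simp
  have "w\<^sup>2 * (1 - c\<^sup>2) = sig \<kappa>" using w sig_simps(1)[of \<kappa>] by (metis mult.assoc mult.left_commute mult_1)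
  then have one: "w = w ^ 3 * sig \<kappa> * (1 - c\<^sup>2)"
    using \<open>w\<^sup>2 * (sig \<kappa> * (1 - c\<^sup>2)) = 1\<close> by (simp add: power2_eq_square power3_eq_cube mult_ac) (metis mult.assoc mult.commute mult_1)
  have "((\<lambda>s. cosine s i j * cosec s i j) has_real_derivative
    \<kappa> * D * w + sig \<kappa> * c * (\<kappa> * D) * w ^ 3 * c) (at t)"
    using DERIV_mult[OF cosine_deriv cosec_deriv, of t i j i j] assms by (simp add: c_def w_def D_def)
  also have "\<kappa> * D * w + sig \<kappa> * c * (\<kappa> * D) * w ^ 3 * c = \<kappa> * D * (w + sig \<kappa> * c\<^sup>2 * w ^ 3)"
    by (simp add: algebra_simps power2_eq_square)
  also have "w + sig \<kappa> * c\<^sup>2 * w ^ 3 = sig \<kappa> * w ^ 3"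
    by (subst one) (simp add: algebra_simps)
  also have "\<kappa> * D * (sig \<kappa> * w ^ 3) = \<bar>\<kappa>\<bar> * D * w ^ 3" by (simp flip: sig_simps(3)[OF \<kappa>])
  finally show ?thesis by (simp add: D_def w_def odot_commute)
qed

definition energy :: "real \<Rightarrow> real" where
  "energy t = (\<Sum>i\<in>{1..n}. odot \<kappa> (p t i) (p t i) / (2 * m i))
     - (\<Sum>i\<in>{1..n}. \<Sum>j\<in>{1..n} - {i}. m i * m j * sqrt \<bar>\<kappa>\<bar> * (cosine t i j * cosec t i j)) / 2"

text \<open>
  The constraint force is normal to the surface and does no work, and the part of each attracting
  force along \<open>q\<^sub>i\<close> drops out for the same reason. The power of the force of \<open>j\<close> on \<open>i\<close> is \<open>T i j\<close>,
  while the potential of the pair changes at the rate \<open>T i j + T j i\<close>; the sum over ordered pairs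
  counts it twice.
\<close>
lemma energy_deriv:
  assumes t: "t \<in> {0<..<ts}"
  shows "(energy has_real_derivative 0) (at t)"
proof -
  define T where "T i j = m i * m j * \<bar>\<kappa>\<bar> powr (3/2) * cosec t i j ^ 3 * odot \<kappa> (vel t i) (q t j)" for i j
  have t': "t \<in> {0..<ts}" using t by auto
  have kin: "((\<lambda>s. odot \<kappa> (p s i) (p s i) / (2 * m i)) has_real_derivative (\<Sum>j\<in>{1..n} - {i}. T i j)) (at t)"
    if i: "i \<in> {1..n}" for i
  proof -
    have pq: "odot \<kappa> (p t i) (q t i) = 0" using tangent[OF t' i] by (simp add: odot_commute)
    have "odot \<kappa> (p t i) (accel t i) / m i = (\<Sum>j\<in>{1..n} - {i}. T i j)"
      by (simp add: accel_def odot_linear pq force_eq[OF t' i] odot_sum_right sum_divide_distrib T_def vel_def)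
    then show ?thesis
      using DERIV_cdivide[OF odot_has_real_derivative[OF p_deriv[OF t i] p_deriv[OF t i]], of \<kappa> "2 * m i"]
      by (simp add: odot_commute[of _ "accel t i"])
  qed
  have "\<bar>\<kappa>\<bar> powr (3/2) = \<bar>\<kappa>\<bar> powr (1 + 1/2)" by simp
  then have K: "\<bar>\<kappa>\<bar> powr (3/2) = \<bar>\<kappa>\<bar> * sqrt \<bar>\<kappa>\<bar>"
    unfolding powr_add by (simp add: powr_half_sqrt)
  have pot: "((\<lambda>s. m i * m j * sqrt \<bar>\<kappa>\<bar> * (cosine s i j * cosec s i j)) has_real_derivative T i j + T j i) (at t)"
    if "i \<in> {1..n}" "j \<in> {1..n} - {i}" for i j
  proof -
    have "cosec t j i = cosec t i j" by (simp add: cosec_def separation_def gap_commute)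
    then show ?thesis
      using DERIV_cmult[OF pair_potential_deriv[OF t, of i j], of "m i * m j * sqrt \<bar>\<kappa>\<bar>"] that
      by (simp add: T_def K algebra_simps)
  qed
  have "(energy has_real_derivative (\<Sum>i\<in>{1..n}. \<Sum>j\<in>{1..n} - {i}. T i j)
     - (\<Sum>i\<in>{1..n}. \<Sum>j\<in>{1..n} - {i}. T i j + T j i) / 2) (at t)"
    unfolding energy_def[abs_def]
    by (intro DERIV_diff DERIV_sum kin DERIV_cdivide pot)
  moreover have "(\<Sum>i\<in>{1..n}. \<Sum>j\<in>{1..n} - {i}. T i j + T j i) = 2 * (\<Sum>i\<in>{1..n}. \<Sum>j\<in>{1..n} - {i}. T i j)"
    using sum_offdiag_swap[of "{1..n}" T] by (simp add: sum.distrib)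
  ultimately show ?thesis by simp
qed

lemma energy_constant: "\<exists>E. \<forall>t\<in>{0<..<ts}. energy t = E"
  by (rule has_field_derivative_zero_constant[OF _ has_field_derivative_at_within[OF energy_deriv]]) auto

lemma separation_lipschitz:
  assumes xy: "x \<le> y" "{x..y} \<subseteq> {0<..<ts}" and V: "0 \<le> V" and i: "i \<in> {1..n}" and j: "j \<in> {1..n}"
    and "\<And>t. t \<in> {x..y} \<Longrightarrow> odot \<kappa> (vel t i) (vel t i) \<le> V\<^sup>2"
    and "\<And>t. t \<in> {x..y} \<Longrightarrow> odot \<kappa> (vel t j) (vel t j) \<le> V\<^sup>2"
  shows "\<bar>ln (1 + separation y i j) - ln (1 + separation x i j)\<bar> \<le> 4 * sqrt \<bar>\<kappa>\<bar> * V * (y - x)"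
  unfolding separation_def
proof (rule ln_gap_lipschitz[where f' = "\<lambda>t. vel t i" and g' = "\<lambda>t. vel t j"])
  fix t assume "t \<in> {x..y}"
  with xy have t: "t \<in> {0<..<ts}" "t \<in> {0..<ts}" by auto
  show "((\<lambda>t. q t i) has_vector_derivative vel t i) (at t within {x..y})"
    "((\<lambda>t. q t j) has_vector_derivative vel t j) (at t within {x..y})"
    using q_deriv[OF t(1)] i j by (blast intro: has_vector_derivative_at_within)+
  show "\<kappa> * odot \<kappa> (q t i) (q t i) = 1" "\<kappa> * odot \<kappa> (q t j) (q t j) = 1"
    using on_surface[OF t(2)] i j by blast+
  show "odot \<kappa> (q t i) (vel t i) = 0" "odot \<kappa> (q t j) (vel t j) = 0"
    using vel_tangent[OF t(2)] i j by blast+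
qed (use assms in auto)

definition separated :: "real \<Rightarrow> real \<Rightarrow> bool" where
  "separated e t \<longleftrightarrow> (\<forall>i\<in>{1..n}. \<forall>j\<in>{1..n}. i \<noteq> j \<longrightarrow> e \<le> separation t i j)"

text \<open>
  The potential of a separated configuration is bounded because \<open>\<bar>c\<bar> w \<le> sqrt (1 + 1 / s)\<close>, even at
  arbitrarily large distances. Each kinetic energy is nonnegative, so the energy bounds all of them.
\<close>
lemma speed_bound:
  assumes "0 < e"
  shows "\<exists>V\<ge>0. \<forall>t\<in>{0<..<ts}. separated e t \<longrightarrow> (\<forall>i\<in>{1..n}. odot \<kappa> (vel t i) (vel t i) \<le> V\<^sup>2)"
proof -
  obtain E where E: "\<And>t. t \<in> {0<..<ts} \<Longrightarrow> energy t = E" using energy_constant by auto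
  define B where "B = (\<Sum>i\<in>{1..n}. \<Sum>j\<in>{1..n} - {i}. m i * m j * sqrt \<bar>\<kappa>\<bar> * sqrt (1 + 1 / e)) / 2"
  define W where "W = (\<Sum>i\<in>{1..n}. 2 * \<bar>E + B\<bar> / m i)"
  have W0: "0 \<le> W" unfolding W_def using m by (intro sum_nonneg) (auto simp: less_imp_le)
  have "odot \<kappa> (vel t i) (vel t i) \<le> W" if t: "t \<in> {0<..<ts}" and i: "i \<in> {1..n}"
    and sep: "separated e t" for t i
  proof -
    have t': "t \<in> {0..<ts}" using t by auto
    have pot: "cosine t i j * cosec t i j \<le> sqrt (1 + 1 / e)"
      if ij: "i \<in> {1..n}" "j \<in> {1..n} - {i}" for i j
    proof -
      define g where "g = separation t i j"
      have "e \<le> g" using sep ij unfolding separated_def g_def by auto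
      with \<open>0 < e\<close> have g: "e \<le> g" "0 < g" by auto
      have "\<bar>cosine t i j\<bar> \<le> sqrt (1 + g)"
        unfolding cosine_def g_def separation_def
        by (rule odot_le_sqrt_gap) (use g in \<open>simp add: g_def separation_def\<close>)
      then have "\<bar>cosine t i j\<bar> / sqrt g \<le> sqrt (1 + g) / sqrt g"
        using g by (intro divide_right_mono) auto
      also have "\<dots> = sqrt (1 + 1 / g)" using g by (simp add: field_simps flip: real_sqrt_divide)
      also have "\<dots> \<le> sqrt (1 + 1 / e)" using g \<open>0 < e\<close> by (simp add: frac_le)
      finally have "\<bar>cosine t i j\<bar> / sqrt g \<le> sqrt (1 + 1 / e)" .
      moreover have "cosine t i j / sqrt g \<le> \<bar>cosine t i j\<bar> / sqrt g"
        using g by (intro divide_right_mono) auto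
      ultimately show ?thesis by (simp add: cosec_def g_def)
    qed
    have nn: "0 \<le> odot \<kappa> (p t i) (p t i)" if "i \<in> {1..n}" for i
      by (rule odot_tangent_nonneg[OF on_surface tangent]) (use t' that in auto)
    have "odot \<kappa> (p t i) (p t i) / (2 * m i) \<le> (\<Sum>i\<in>{1..n}. odot \<kappa> (p t i) (p t i) / (2 * m i))"
      by (rule member_le_sum) (use i nn m in \<open>auto simp: less_imp_le\<close>)
    also have "\<dots> = E + (\<Sum>i\<in>{1..n}. \<Sum>j\<in>{1..n} - {i}. m i * m j * sqrt \<bar>\<kappa>\<bar> * (cosine t i j * cosec t i j)) / 2"
      using E[OF t] by (simp add: energy_def)
    also have "\<dots> \<le> E + B"
      unfolding B_def
      by (intro add_left_mono divide_right_mono sum_mono mult_left_mono pot mult_nonneg_nonneg)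
        (use m in \<open>auto simp: less_imp_le\<close>)
    finally have "odot \<kappa> (p t i) (p t i) / (2 * m i) \<le> \<bar>E + B\<bar>" by linarith
    then have "odot \<kappa> (vel t i) (vel t i) \<le> 2 * \<bar>E + B\<bar> / m i"
      using m[OF i] by (simp add: vel_def odot_linear field_simps)
    also have "\<dots> \<le> W" unfolding W_def
      by (rule member_le_sum) (use i m in \<open>auto simp: less_imp_le\<close>)
    finally show ?thesis .
  qed
  then show ?thesis using W0 by (intro exI[of _ "sqrt W"]) simp
qed

text \<open>
  The core of the argument: separation at times arbitrarily close to \<open>ts\<close> implies separation at all
  times close to \<open>ts\<close>. As long as the separation exceeds \<open>e / 2\<close>, the speeds are bounded by a
  constant that does not depend on the starting time, hence \<open>ln (1 + separation)\<close> is Lipschitz. Starting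
  from a time at distance less than \<open>\<delta>\<close> from \<open>ts\<close> it cannot drop from \<open>ln (1 + e)\<close> to
  \<open>ln (1 + e / 2)\<close>.
\<close>
lemma separation_persists:
  assumes "0 < e" and recur: "\<And>b. b < ts \<Longrightarrow> \<exists>t. b < t \<and> t < ts \<and> separated e t"
  shows "\<exists>t1. 0 < t1 \<and> t1 < ts \<and> (\<forall>t\<in>{t1..<ts}. separated (e / 2) t)"
proof -
  have half: "0 < e / 2" using \<open>0 < e\<close> by simp
  obtain V where V: "0 \<le> V" and speed: "\<And>t i. t \<in> {0<..<ts} \<Longrightarrow> separated (e / 2) t \<Longrightarrow>
       i \<in> {1..n} \<Longrightarrow> odot \<kappa> (vel t i) (vel t i) \<le> V\<^sup>2"
    using speed_bound[OF half] by blast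
  \<comment> \<open>The summand 1 avoids a division by zero when \<open>V = 0\<close>.\<close>
  define L where "L = 4 * sqrt \<bar>\<kappa>\<bar> * V + 1"
  have L: "0 < L" "4 * sqrt \<bar>\<kappa>\<bar> * V \<le> L" using V by (auto simp: L_def add_nonneg_pos)
  define \<delta> where "\<delta> = (ln (1 + e) - ln (1 + e / 2)) / L"
  have "0 < \<delta>" using \<open>0 < e\<close> L by (auto simp: \<delta>_def)
  then obtain t1 where t1: "max 0 (ts - \<delta>) < t1" "t1 < ts"
    and start: "\<And>i j. i \<in> {1..n} \<Longrightarrow> j \<in> {1..n} \<Longrightarrow> i \<noteq> j \<Longrightarrow> e \<le> separation t1 i j"
    using recur[of "max 0 (ts - \<delta>)"] ts unfolding separated_def by auto
  define I where "I = {(i, j). i \<in> {1..n} \<and> j \<in> {1..n} \<and> i \<noteq> j}"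
  have "finite I" by (rule finite_subset[of _ "{1..n} \<times> {1..n}"]) (auto simp: I_def)
  have cont: "continuous_on {t1..<ts} (\<lambda>t. case k of (i, j) \<Rightarrow> separation t i j)" if kI: "k \<in> I" for k
  proof -
    obtain i j where k: "k = (i, j)" "i \<in> {1..n}" "j \<in> {1..n}"
      using kI by (cases k) (auto simp: I_def)
    have "isCont (\<lambda>t. separation t i j) t" if "t \<in> {t1..<ts}" for t
      unfolding separation_def
      by (rule DERIV_isCont[OF gap_has_real_derivative[OF q_deriv q_deriv]]) (use that t1 k in auto)
    then show ?thesis by (simp add: k(1) continuous_at_imp_continuous_on)
  qed
  have step: "e / 2 < (case k of (i, j) \<Rightarrow> separation T i j)"
    if T: "t1 \<le> T" "T < ts" and k: "k \<in> I"
      and before: "\<And>t k. t1 \<le> t \<Longrightarrow> t < T \<Longrightarrow> k \<in> I \<Longrightarrow> e / 2 < (case k of (i, j) \<Rightarrow> separation t i j)" for T k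
  proof -
    obtain i j where ij: "k = (i, j)" "i \<in> {1..n}" "j \<in> {1..n}" "i \<noteq> j"
      using k by (cases k) (auto simp: I_def)
    show ?thesis
    proof (cases "T = t1")
      case True
      then show ?thesis using start[OF ij(2-4)] \<open>0 < e\<close> ij(1) by simp
    next
      case False
      \<comment> \<open>The speed bound is known only before \<open>T\<close>; the estimate reaches \<open>T\<close> by continuity.\<close>
      have near: "ln (1 + e) - L * (T - t1) \<le> ln (1 + separation x i j)" if x: "t1 < x" "x < T" for x
      proof -
        have sp: "odot \<kappa> (vel t k) (vel t k) \<le> V\<^sup>2" if "t \<in> {t1..x}" "k \<in> {1..n}" for t k
        proof (rule speed)
          show "separated (e / 2) t"
            unfolding separated_def
          proof (intro ballI impI)
            fix a b assume "a \<in> {1..n}" "b \<in> {1..n}" "a \<noteq> b"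
            then have "(a, b) \<in> I" by (simp add: I_def)
            from before[OF _ _ this, of t] show "e / 2 \<le> separation t a b"
              using that x by simp
          qed
        qed (use that x T t1 in auto)
        have "\<bar>ln (1 + separation x i j) - ln (1 + separation t1 i j)\<bar> \<le> 4 * sqrt \<bar>\<kappa>\<bar> * V * (x - t1)"
          by (rule separation_lipschitz[OF _ _ V ij(2,3) sp sp]) (use x T t1 ij in auto)
        moreover have "4 * sqrt \<bar>\<kappa>\<bar> * V * (x - t1) \<le> L * (T - t1)"
          using x L V by (intro mult_mono) auto
        moreover have "ln (1 + e) \<le> ln (1 + separation t1 i j)"
          using start[OF ij(2-4)] \<open>0 < e\<close> by simp
        ultimately show ?thesis by linarith
      qed
      have "t1 < T" using False T by simp
      have pos: "0 < separation T i j" using separation_pos[of T i j] T t1 ij by auto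
      have "isCont (\<lambda>t. separation t i j) T"
        unfolding separation_def
        by (rule DERIV_isCont[OF gap_has_real_derivative[OF q_deriv q_deriv]]) (use T t1 ij in auto)
      then have "((\<lambda>x. ln (1 + separation x i j)) \<longlongrightarrow> ln (1 + separation T i j)) (at_left T)"
        using pos by (intro tendsto_intros) (auto intro: isCont_def[THEN iffD1] tendsto_within_subset simp: isCont_def)
      then have "ln (1 + e) - L * (T - t1) \<le> ln (1 + separation T i j)"
      proof (rule tendsto_lowerbound)
        show "\<forall>\<^sub>F x in at_left T. ln (1 + e) - L * (T - t1) \<le> ln (1 + separation x i j)"
          unfolding eventually_at_left[OF \<open>t1 < T\<close>] using near \<open>t1 < T\<close> by (intro exI[of _ t1]) auto
      qed simp
      moreover have "L * (T - t1) < L * \<delta>" using L t1 T by (intro mult_strict_left_mono) auto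
      moreover have "L * \<delta> = ln (1 + e) - ln (1 + e / 2)" using L by (simp add: \<delta>_def)
      ultimately have "ln (1 + e / 2) < ln (1 + separation T i j)" by linarith
      then show ?thesis using pos \<open>0 < e\<close> ij(1) by simp
    qed
  qed
  have "e / 2 < separation t i j" if "t \<in> {t1..<ts}" "i \<in> {1..n}" "j \<in> {1..n}" "i \<noteq> j" for t i j
  proof -
    have k: "(i, j) \<in> I" using that by (simp add: I_def)
    have "e / 2 < (case (i, j) of (i, j) \<Rightarrow> separation t i j)"
      by (rule bootstrap_lower_bound[OF \<open>finite I\<close> cont step that(1) k])
    then show ?thesis by simp
  qed
  then have "separated (e / 2) t" if "t \<in> {t1..<ts}" for t
    using that unfolding separated_def by (meson less_imp_le)
  then show ?thesis using t1 by (intro exI[of _ t1]) simp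
qed

end

section \<open>Transferring and gluing analytic solutions\<close>

lemma vec_has_vector_derivative:
  fixes f :: "real \<Rightarrow> real ^ 'n"
  assumes "\<And>k. ((\<lambda>s. f s $ k) has_real_derivative f' $ k) (at t)"
  shows "(f has_vector_derivative f') (at t)"
  unfolding has_vector_derivative_def
proof (subst has_derivative_componentwise_within, intro ballI)
  fix b :: "real ^ 'n" assume "b \<in> Basis"
  then obtain k where b: "b = axis k 1" by (auto simp: Basis_vec_def)
  show "((\<lambda>s. f s \<bullet> b) has_derivative (\<lambda>h. (h *\<^sub>R f') \<bullet> b)) (at t)"
    using assms[of k] unfolding b has_field_derivative_def by (simp add: inner_axis mult.commute[of _ "f' $ k"])
qed

text \<open>
  A differential equation satisfied by \<open>g\<close> passes to its extension \<open>F\<close>, because the derivative of \<open>F\<close>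
  and the right-hand side \<open>D\<close> are analytic and agree where \<open>F\<close> agrees with \<open>g\<close>.
\<close>
lemma holo_ext_transfer_deriv:
  assumes F: "holo_ext c r F" and D: "holo_ext c r D"
    and b: "c - r < b" "b < c + r"
    and g: "\<And>t. t \<in> {c - r<..<b} \<Longrightarrow> (g has_real_derivative D t) (at t)"
      "\<And>t. t \<in> {c - r<..<b} \<Longrightarrow> F t = g t"
    and t: "t \<in> ball c r"
  shows "(F has_real_derivative D t) (at t)"
proof -
  obtain F' where F': "holo_ext c r F'" "\<And>t. t \<in> ball c r \<Longrightarrow> (F has_real_derivative F' t) (at t)"
    using holo_ext_deriv[OF F] by blast
  have sub: "{c - r<..<b} \<subseteq> ball c r" using b by (auto simp: ball_eq_greaterThanLessThan)
  have "F' t = D t"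
  proof (rule holo_ext_identity[OF F'(1) D b(1) sub _ t])
    fix s assume s: "s \<in> {c - r<..<b}"
    have "(F has_real_derivative D s) (at s)"
      by (rule has_field_derivative_transform_within_open[OF g(1)[OF s], of "{c - r<..<b}"])
        (use s g(2) in auto)
    moreover have "(F has_real_derivative F' s) (at s)" using F'(2) s sub by blast
    ultimately show "F' s = D s" by (rule DERIV_unique[rotated])
  qed
  with F'(2)[OF t] show ?thesis by simp
qed

lemma holo_ext_real_analytic:
  fixes f :: "real \<Rightarrow> real ^ 'n"
  assumes f: "\<And>k. holo_ext c r (\<lambda>t. f t $ k)"
  shows "real_analytic_on f (ball c r)"
  unfolding real_analytic_on_def
proof
  fix s assume s: "s \<in> ball c r"
  have "\<exists>\<rho> a. 0 < \<rho> \<and> (\<forall>t. \<bar>t - s\<bar> < \<rho> \<longrightarrow> (\<lambda>j. (t - s) ^ j * a j) sums (f t $ k))" for k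
    using holo_ext_power_series[OF f[of k] s] by metis
  then obtain \<rho> a where \<rho>: "\<And>k. 0 < \<rho> k"
    "\<And>k t. \<bar>t - s\<bar> < \<rho> k \<Longrightarrow> (\<lambda>j. (t - s) ^ j * a k j) sums (f t $ k)" by metis
  define e where "e = Min (range \<rho>)"
  have e: "0 < e" "e \<le> \<rho> k" for k using \<rho>(1) by (auto simp: e_def)
  define v where "v j = (\<chi> k. a k j)" for j
  have "(\<lambda>j. (t - s) ^ j *\<^sub>R v j) sums f t" if "\<bar>t - s\<bar> < e" for t
    unfolding sums_def
  proof (rule vec_tendstoI)
    fix k
    have "(\<lambda>j. (t - s) ^ j * a k j) sums (f t $ k)" using \<rho>(2)[of t k] e(2)[of k] that by linarith
    then show "(\<lambda>n. (\<Sum>j<n. (t - s) ^ j *\<^sub>R v j) $ k) \<longlonglongrightarrow> f t $ k"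
      by (simp add: sums_def v_def)
  qed
  then show "\<exists>e>0. \<exists>v. \<forall>t\<in>ball c r. \<bar>t - s\<bar> < e \<longrightarrow> (\<lambda>j. (t - s) ^ j *\<^sub>R v j) sums f t"
    using e(1) by (intro exI[of _ e] conjI exI[of _ v]) auto
qed

lemma holo_ext_odot:
  assumes "\<And>k. holo_ext c r (\<lambda>t. f t $ k)" "\<And>k. holo_ext c r (\<lambda>t. g t $ k)"
  shows "holo_ext c r (\<lambda>t. odot \<kappa> (f t) (g t))"
  unfolding odot_def by (intro holo_ext_intros assms)

lemma polys_odot:
  assumes "\<And>k. (\<lambda>t. f t $ k) \<in> polys G" "\<And>k. (\<lambda>t. g t $ k) \<in> polys G"
  shows "(\<lambda>t. odot \<kappa> (f t) (g t)) \<in> polys G"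
  unfolding odot_def by (intro polys_intros assms)

lemma real_analytic_on_glue:
  assumes f: "real_analytic_on f {a..<b}" and g: "real_analytic_on g {a'<..<c}"
    and ord: "a \<le> a'" "a' < b" "b < c" and eq: "\<And>t. t \<in> {a'<..<b} \<Longrightarrow> f t = g t"
  shows "real_analytic_on (\<lambda>t. if t < b then f t else g t) {a..<c}"
  unfolding real_analytic_on_def
proof
  fix s assume s: "s \<in> {a..<c}"
  show "\<exists>r>0. \<exists>v. \<forall>t\<in>{a..<c}. \<bar>t - s\<bar> < r \<longrightarrow> (\<lambda>k. (t - s) ^ k *\<^sub>R v k) sums (if t < b then f t else g t)"
  proof (cases "s < b")
    case True
    then obtain r v where r: "0 < r" "\<forall>t\<in>{a..<b}. \<bar>t - s\<bar> < r \<longrightarrow> (\<lambda>k. (t - s) ^ k *\<^sub>R v k) sums f t"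
      using f s unfolding real_analytic_on_def by (metis atLeastLessThan_iff)
    then show ?thesis using True by (intro exI[of _ "min r (b - s)"] conjI exI[of _ v]) auto
  next
    case False
    then have "s \<in> {a'<..<c}" using s ord by auto
    then obtain r v where r: "0 < r" "\<forall>t\<in>{a'<..<c}. \<bar>t - s\<bar> < r \<longrightarrow> (\<lambda>k. (t - s) ^ k *\<^sub>R v k) sums g t"
      using g unfolding real_analytic_on_def by blast
    have "(\<lambda>k. (t - s) ^ k *\<^sub>R v k) sums (if t < b then f t else g t)"
      if "t \<in> {a..<c}" "\<bar>t - s\<bar> < min r (s - a')" for t
    proof -
      have t: "t \<in> {a'<..<c}" "\<bar>t - s\<bar> < r" using that by auto
      have "(if t < b then f t else g t) = g t" using eq t(1) by auto
      then show ?thesis using r(2) t by simp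
    qed
    then show ?thesis using r(1) False ord
      by (intro exI[of _ "min r (s - a')"] conjI exI[of _ v]) auto
  qed
qed

lemma has_vector_derivative_glue:
  assumes ord: "a \<le> a'" "a' < b" "b < c" and t: "t \<in> {a..<c}"
    and eq: "\<And>s. s \<in> {a'<..<b} \<Longrightarrow> f s = g s"
    and f: "t < b \<Longrightarrow> (f has_vector_derivative d) (at t within {a..<b})"
    and g: "b \<le> t \<Longrightarrow> (g has_vector_derivative d) (at t within {a'<..<c})"
  shows "((\<lambda>s. if s < b then f s else g s) has_vector_derivative d) (at t within {a..<c})"
proof (cases "t < b")
  case True
  have "at t within {a..<c} = at t within {a..<b}"
    by (rule at_within_nhd[of _ "{..<b}"]) (use True ord in auto)
  moreover have "((\<lambda>s. if s < b then f s else g s) has_vector_derivative d) (at t within {a..<b})"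
    by (rule has_vector_derivative_transform[OF _ _ f[OF True]]) (use True t in auto)
  ultimately show ?thesis by simp
next
  case False
  then have tb: "b \<le> t" by simp
  have "at t within {a..<c} = at t within {a'<..<c}"
    by (rule at_within_nhd[of _ "{a'<..}"]) (use tb ord in auto)
  moreover have "((\<lambda>s. if s < b then f s else g s) has_vector_derivative d) (at t within {a'<..<c})"
    by (rule has_vector_derivative_transform[OF _ _ g[OF tb]]) (use tb t ord eq in auto)
  ultimately show ?thesis by simp
qed

text \<open>
  Being an analytic solution is a local condition, and every point of the longer interval has a
  neighbourhood on which the combined curve agrees with one of the two given ones.
\<close>
lemma solution_glue:
  assumes old: "analytic_solution_on \<kappa> n m {0..<b} q p"
    and new: "analytic_solution_on \<kappa> n m {a<..<c} Q P"
    and ord: "0 \<le> a" "a < b" "b < c"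
    and eq: "\<And>t i. t \<in> {a<..<b} \<Longrightarrow> i \<in> {1..n} \<Longrightarrow> q t i = Q t i \<and> p t i = P t i"
  shows "analytic_solution_on \<kappa> n m {0..<c}
    (\<lambda>t i. if t < b then q t i else Q t i) (\<lambda>t i. if t < b then p t i else P t i)"
  unfolding analytic_solution_on_def solution_on_def
proof (intro conjI ballI)
  let ?q = "\<lambda>t i. if t < b then q t i else Q t i" and ?p = "\<lambda>t i. if t < b then p t i else P t i"
  have qs: "solution_on \<kappa> n m {0..<b} q p" and Qs: "solution_on \<kappa> n m {a<..<c} Q P"
    using old new by (auto simp: analytic_solution_on_def)
  note q = qs[unfolded solution_on_def] and Q = Qs[unfolded solution_on_def]
  {
    fix t assume t: "t \<in> {0..<c}"
    show "?q t \<notin> singular_set \<kappa> n"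
    proof (cases "t < b")
      case True
      then show ?thesis using q t by simp
    next
      case False
      then show ?thesis using Q t ord by simp
    qed
  }
  fix i assume i: "i \<in> {1..n}"
  show "real_analytic_on (\<lambda>t. ?q t i) {0..<c}"
    by (rule real_analytic_on_glue[OF _ _ ord]) (use old new i eq in \<open>auto simp: analytic_solution_on_def\<close>)
  show "real_analytic_on (\<lambda>t. ?p t i) {0..<c}"
    by (rule real_analytic_on_glue[OF _ _ ord]) (use old new i eq in \<open>auto simp: analytic_solution_on_def\<close>)
  fix t assume t: "t \<in> {0..<c}"
  have tt: "t < b \<Longrightarrow> t \<in> {0..<b}" "\<not> t < b \<Longrightarrow> t \<in> {a<..<c}" using t ord by auto
  show "?q t i \<in> M2 \<kappa>"
    using q Q i tt by (cases "t < b") (simp_all only: if_True if_False simp_thms)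
  show "odot \<kappa> (?q t i) (?p t i) = 0"
    using q Q i tt by (cases "t < b") (simp_all only: if_True if_False simp_thms)
  show "((\<lambda>s. ?q s i) has_vector_derivative (1 / m i) *\<^sub>R ?p t i) (at t within {0..<c})"
  proof (rule has_vector_derivative_glue[OF ord t])
    show "q s i = Q s i" if "s \<in> {a<..<b}" for s using eq[OF that i] by simp
    show "((\<lambda>s. q s i) has_vector_derivative (1 / m i) *\<^sub>R ?p t i) (at t within {0..<b})" if "t < b"
      using q i tt(1)[OF that] that by simp
    show "((\<lambda>s. Q s i) has_vector_derivative (1 / m i) *\<^sub>R ?p t i) (at t within {a<..<c})" if "b \<le> t"
      using Q i tt(2) that by simp
  qed
  show "((\<lambda>s. ?p s i) has_vector_derivative
      grad_U \<kappa> n m (?q t) i - ((1 / m i) * \<kappa> * odot \<kappa> (?p t i) (?p t i)) *\<^sub>R ?q t i) (at t within {0..<c})"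
  proof (rule has_vector_derivative_glue[OF ord t])
    show "p s i = P s i" if "s \<in> {a<..<b}" for s using eq[OF that i] by simp
    show "((\<lambda>s. p s i) has_vector_derivative
      grad_U \<kappa> n m (?q t) i - ((1 / m i) * \<kappa> * odot \<kappa> (?p t i) (?p t i)) *\<^sub>R ?q t i) (at t within {0..<b})"
      if "t < b"
      using q i tt(1)[OF that] that by simp
    show "((\<lambda>s. P s i) has_vector_derivative
      grad_U \<kappa> n m (?q t) i - ((1 / m i) * \<kappa> * odot \<kappa> (?p t i) (?p t i)) *\<^sub>R ?q t i) (at t within {a<..<c})"
      if "b \<le> t"
      using Q i tt(2) that by simp
  qed
qed

section \<open>Bounds near the end of the interval and analytic extension\<close>

context curved_motion
begin

text \<open>
  The Lipschitz estimate is applied with the second curve at rest at the pole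
  \<open>(0, 0, 1 / sqrt \<bar>\<kappa>\<bar>)\<close> of the surface: in finite time the body stays within a bounded distance of the
  pole, which bounds its height, and the equation of the surface then bounds the horizontal
  coordinates.
\<close>
lemma position_bound:
  assumes t1: "0 < t1" "t1 < ts" and V: "0 \<le> V"
    and speed: "\<And>t i. t \<in> {t1..<ts} \<Longrightarrow> i \<in> {1..n} \<Longrightarrow> odot \<kappa> (vel t i) (vel t i) \<le> V\<^sup>2"
    and i: "i \<in> {1..n}"
  shows "\<exists>B. \<forall>t\<in>{t1..<ts}. \<forall>k. (q t i $ k)\<^sup>2 \<le> B"
proof -
  define N :: "real ^ 3" where "N = axis 3 (1 / sqrt \<bar>\<kappa>\<bar>)"
  have N: "N $ 1 = 0" "N $ 2 = 0" "N $ 3 = 1 / sqrt \<bar>\<kappa>\<bar>" by (simp_all add: N_def axis_def)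
  have "odot \<kappa> N N = sig \<kappa> / \<bar>\<kappa>\<bar>" by (simp add: odot_def N)
  then have NN: "\<kappa> * odot \<kappa> N N = 1"
    using \<kappa> by (simp add: sig_simps(3)[OF \<kappa>, symmetric] sig_def)
  define g where "g t = gap \<kappa> (q t i) N" for t
  have g0: "0 \<le> g t" if "t \<in> {t1..<ts}" for t
    unfolding g_def by (rule gap_nonneg[OF on_surface NN]) (use that t1 i in auto)
  define C where "C = exp (ln (1 + g t1) + 4 * sqrt \<bar>\<kappa>\<bar> * V * (ts - t1))"
  have gC: "1 + g t \<le> C" if t: "t \<in> {t1..<ts}" for t
  proof -
    have "\<bar>ln (1 + gap \<kappa> (q t i) N) - ln (1 + gap \<kappa> (q t1 i) N)\<bar> \<le> 4 * sqrt \<bar>\<kappa>\<bar> * V * (t - t1)"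
    proof (rule ln_gap_lipschitz[where f' = "\<lambda>t. vel t i" and g' = "\<lambda>t. 0"])
      fix s assume s: "s \<in> {t1..t}"
      then have s': "s \<in> {0<..<ts}" "s \<in> {0..<ts}" "s \<in> {t1..<ts}" using t t1 by auto
      show "((\<lambda>t. q t i) has_vector_derivative vel s i) (at s within {t1..t})"
        by (rule has_vector_derivative_at_within[OF q_deriv[OF s'(1) i]])
      show "\<kappa> * odot \<kappa> (q s i) (q s i) = 1" by (rule on_surface[OF s'(2) i])
      show "odot \<kappa> (q s i) (vel s i) = 0" by (rule vel_tangent[OF s'(2) i])
      show "odot \<kappa> (vel s i) (vel s i) \<le> V\<^sup>2" by (rule speed[OF s'(3) i])
      show "((\<lambda>t. N) has_vector_derivative 0) (at s within {t1..t})"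
        by (rule has_vector_derivative_const)
    qed (use t V NN in \<open>auto simp: odot_linear\<close>)
    moreover have "4 * sqrt \<bar>\<kappa>\<bar> * V * (t - t1) \<le> 4 * sqrt \<bar>\<kappa>\<bar> * V * (ts - t1)"
      using t V by (intro mult_left_mono) auto
    ultimately have "ln (1 + g t) \<le> ln (1 + g t1) + 4 * sqrt \<bar>\<kappa>\<bar> * V * (ts - t1)"
      unfolding g_def by linarith
    then have "exp (ln (1 + g t)) \<le> C" unfolding C_def by simp
    then show ?thesis using g0[OF t] by simp
  qed
  have "(q t i $ k)\<^sup>2 \<le> 1 / \<bar>\<kappa>\<bar> + C / \<bar>\<kappa>\<bar>" if t: "t \<in> {t1..<ts}" for t k
  proof -
    define x y z where "x = q t i $ 1" and "y = q t i $ 2" and "z = q t i $ 3"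
    have "\<bar>\<kappa> * odot \<kappa> (q t i) N\<bar> \<le> sqrt (1 + g t)"
      unfolding g_def by (rule odot_le_sqrt_gap) (use g0[OF t] in \<open>simp add: g_def\<close>)
    then have "\<bar>\<kappa> * odot \<kappa> (q t i) N\<bar>\<^sup>2 \<le> (sqrt (1 + g t))\<^sup>2" by (rule power_mono) simp
    then have "(\<kappa> * odot \<kappa> (q t i) N)\<^sup>2 \<le> C" using gC[OF t] g0[OF t] by simp
    moreover have "\<kappa> * odot \<kappa> (q t i) N = \<bar>\<kappa>\<bar> / sqrt \<bar>\<kappa>\<bar> * z"
      by (simp add: odot_def N z_def sig_simps(3)[OF \<kappa>, symmetric])
    moreover have "\<bar>\<kappa>\<bar> / sqrt \<bar>\<kappa>\<bar> = sqrt \<bar>\<kappa>\<bar>" by (simp add: real_div_sqrt)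
    ultimately have "\<bar>\<kappa>\<bar> * z\<^sup>2 \<le> C" by (simp add: power_mult_distrib)
    then have z: "z\<^sup>2 \<le> C / \<bar>\<kappa>\<bar>" using \<kappa> by (simp add: field_simps)
    have "\<kappa> * (x\<^sup>2 + y\<^sup>2 + sig \<kappa> * z\<^sup>2) = 1"
      using on_surface[of t i] t t1 i by (simp add: odot_def x_def y_def z_def power2_eq_square mult_ac)
    then have "x\<^sup>2 + y\<^sup>2 = 1 / \<kappa> - sig \<kappa> * z\<^sup>2" using \<kappa> by (simp add: field_simps)
    also have "\<dots> \<le> 1 / \<bar>\<kappa>\<bar> + z\<^sup>2"
      using \<kappa> by (cases "\<kappa> > 0") (auto simp: sig_def)
    finally have "x\<^sup>2 + y\<^sup>2 \<le> 1 / \<bar>\<kappa>\<bar> + C / \<bar>\<kappa>\<bar>" using z by linarith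
    then have "x\<^sup>2 \<le> 1 / \<bar>\<kappa>\<bar> + C / \<bar>\<kappa>\<bar>" "y\<^sup>2 \<le> 1 / \<bar>\<kappa>\<bar> + C / \<bar>\<kappa>\<bar>"
      using zero_le_power2[of x] zero_le_power2[of y] by linarith+
    moreover have "z\<^sup>2 \<le> 1 / \<bar>\<kappa>\<bar> + C / \<bar>\<kappa>\<bar>" using z by (simp add: add_increasing)
    moreover have "k = 1 \<or> k = 2 \<or> k = 3" by (rule exhaust_3)
    ultimately show ?thesis unfolding x_def y_def z_def by (elim disjE) simp_all
  qed
  then show ?thesis by blast
qed

text \<open>
  A component of the velocity is, up to sign, its product with a coordinate vector; the
  Cauchy-Schwarz inequality in the tangent plane bounds it by the speed and the position.
\<close>
lemma momentum_bound:
  assumes t: "t \<in> {0..<ts}" and i: "i \<in> {1..n}"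
    and speed: "odot \<kappa> (vel t i) (vel t i) \<le> V\<^sup>2" and B: "(q t i $ k)\<^sup>2 \<le> B"
  shows "(p t i $ k)\<^sup>2 \<le> (m i)\<^sup>2 * (V\<^sup>2 * (1 + \<bar>\<kappa>\<bar> * B))"
proof -
  define s where "s = (if k = 3 then sig \<kappa> else 1)"
  have s: "s\<^sup>2 = 1" "s \<le> 1" by (auto simp: s_def sig_def)
  have od: "odot \<kappa> v (axis k 1) = s * v $ k" for v
    using exhaust_3[of k] by (auto simp: odot_def axis_def s_def)
  have "(s * vel t i $ k)\<^sup>2 \<le> odot \<kappa> (vel t i) (vel t i) * (s - \<kappa> * (s * q t i $ k)\<^sup>2)"
    using odot_tangent_bound[OF on_surface[OF t i] vel_tangent[OF t i], of "axis k 1"]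
    by (simp add: od)
  also have "\<dots> \<le> odot \<kappa> (vel t i) (vel t i) * (1 + \<bar>\<kappa>\<bar> * B)"
  proof (rule mult_left_mono)
    have "- \<kappa> * (q t i $ k)\<^sup>2 \<le> \<bar>\<kappa>\<bar> * B" using B by (intro mult_mono) auto
    then show "s - \<kappa> * (s * q t i $ k)\<^sup>2 \<le> 1 + \<bar>\<kappa>\<bar> * B"
      using s by (simp add: power_mult_distrib)
    show "0 \<le> odot \<kappa> (vel t i) (vel t i)"
      by (rule odot_tangent_nonneg[OF on_surface[OF t i] vel_tangent[OF t i]])
  qed
  also have "\<dots> \<le> V\<^sup>2 * (1 + \<bar>\<kappa>\<bar> * B)"
  proof (rule mult_right_mono[OF speed])
    have "0 \<le> B" using B by (rule order_trans[rotated]) simp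
    then show "0 \<le> 1 + \<bar>\<kappa>\<bar> * B" by simp
  qed
  finally have "(vel t i $ k)\<^sup>2 \<le> V\<^sup>2 * (1 + \<bar>\<kappa>\<bar> * B)" using s by (simp add: power_mult_distrib)
  then have "(m i)\<^sup>2 * (vel t i $ k)\<^sup>2 \<le> (m i)\<^sup>2 * (V\<^sup>2 * (1 + \<bar>\<kappa>\<bar> * B))"
    by (rule mult_left_mono) simp
  moreover have "p t i $ k = m i * vel t i $ k" using m[OF i] by (simp add: vel_def)
  ultimately show ?thesis by (simp add: power_mult_distrib)
qed

text \<open>
  Positions and momenta alone do not satisfy polynomial equations; together with the reciprocals
  \<open>w = 1 / sqrt s\<close> they do. These functions are the generators of the polynomial system.
\<close>
definition pos_coords :: "(real \<Rightarrow> real) set" where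
  "pos_coords = (\<lambda>(i, k) t. q t i $ k) ` ({1..n} \<times> UNIV)"

definition mom_coords :: "(real \<Rightarrow> real) set" where
  "mom_coords = (\<lambda>(i, k) t. p t i $ k) ` ({1..n} \<times> UNIV)"

definition cosecs :: "(real \<Rightarrow> real) set" where
  "cosecs = (\<lambda>(i, j) t. cosec t i j) ` {(i, j). i \<in> {1..n} \<and> j \<in> {1..n} \<and> i \<noteq> j}"

definition coords :: "(real \<Rightarrow> real) set" where
  "coords = pos_coords \<union> mom_coords \<union> cosecs"

lemma finite_coords: "finite coords"
proof -
  have "finite {(i, j). i \<in> {1..n} \<and> j \<in> {1..n} \<and> i \<noteq> j}"
    by (rule finite_subset[of _ "{1..n} \<times> {1..n}"]) auto
  then show ?thesis
    unfolding coords_def pos_coords_def mom_coords_def cosecs_def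
    by (intro finite_UnI finite_imageI) auto
qed

lemma coords_cases:
  assumes "g \<in> coords"
  obtains i k where "i \<in> {1..n}" "g = (\<lambda>t. q t i $ k)"
  | i k where "i \<in> {1..n}" "g = (\<lambda>t. p t i $ k)"
  | i j where "i \<in> {1..n}" "j \<in> {1..n}" "i \<noteq> j" "g = (\<lambda>t. cosec t i j)"
  using assms unfolding coords_def pos_coords_def mom_coords_def cosecs_def by auto

lemma coords_mem:
  "i \<in> {1..n} \<Longrightarrow> (\<lambda>t. q t i $ k) \<in> coords"
  "i \<in> {1..n} \<Longrightarrow> (\<lambda>t. p t i $ k) \<in> coords"
  "i \<in> {1..n} \<Longrightarrow> j \<in> {1..n} \<Longrightarrow> i \<noteq> j \<Longrightarrow> (\<lambda>t. cosec t i j) \<in> coords"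
  unfolding coords_def pos_coords_def mom_coords_def cosecs_def by (auto intro: rev_image_eqI)

lemma coords_deriv_poly:
  assumes "g \<in> coords"
  shows "\<exists>g'\<in>polys coords. \<forall>t\<in>{0<..<ts}. (g has_real_derivative g' t) (at t)"
proof -
  have Q: "(\<lambda>t. q t i $ k) \<in> polys coords" "(\<lambda>t. p t i $ k) \<in> polys coords" if "i \<in> {1..n}" for i k
    using coords_mem that by (auto intro: polys_gen)
  have V: "(\<lambda>t. vel t i $ k) \<in> polys coords" if "i \<in> {1..n}" for i k
    using polys_mult[OF polys_const[of "1 / m i"] Q(2)[OF that]] by (simp add: vel_def)
  have C: "(\<lambda>t. cosine t i j) \<in> polys coords" if "i \<in> {1..n}" "j \<in> {1..n}" for i j
    unfolding cosine_def using that by (intro polys_intros polys_odot Q)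
  have W: "(\<lambda>t. cosec t i j) \<in> polys coords" if "i \<in> {1..n}" "j \<in> {1..n} - {i}" for i j
    using that by (intro polys_gen coords_mem) auto
  have I: "\<exists>g'\<in>polys coords. \<forall>t\<in>{0<..<ts}. (g has_real_derivative g' t) (at t)"
    if "D \<in> polys coords" "\<And>t. t \<in> {0<..<ts} \<Longrightarrow> (g has_real_derivative D t) (at t)" for D
    using that by blast
  from assms show ?thesis
  proof (cases rule: coords_cases)
    case (1 i k)
    show ?thesis
    proof (rule I)
      show "(\<lambda>t. p t i $ k * (1 / m i)) \<in> polys coords"
        by (intro polys_intros Q 1)
      show "(g has_real_derivative p t i $ k * (1 / m i)) (at t)" if "t \<in> {0<..<ts}" for t
        using q_comp_deriv[OF that 1(1), of k] unfolding 1(2) by simp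
    qed
  next
    case (2 i k)
    show ?thesis
    proof (rule I)
      show "(\<lambda>t. (\<Sum>j\<in>{1..n} - {i}. m i * m j * \<bar>\<kappa>\<bar> powr (3/2) * cosec t i j ^ 3 * (q t j $ k - cosine t i j * q t i $ k))
        - (1 / m i) * \<kappa> * odot \<kappa> (p t i) (p t i) * q t i $ k) \<in> polys coords"
        by (intro polys_intros polys_odot Q C W 2) auto
      show "(g has_real_derivative
         (\<Sum>j\<in>{1..n} - {i}. m i * m j * \<bar>\<kappa>\<bar> powr (3/2) * cosec t i j ^ 3 * (q t j $ k - cosine t i j * q t i $ k))
        - (1 / m i) * \<kappa> * odot \<kappa> (p t i) (p t i) * q t i $ k) (at t)" if "t \<in> {0<..<ts}" for t
        unfolding 2(2) by (rule p_comp_deriv[OF that 2(1)])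
    qed
  next
    case (3 i j)
    show ?thesis
    proof (rule I)
      show "(\<lambda>t. sig \<kappa> * cosine t i j * (\<kappa> * (odot \<kappa> (vel t i) (q t j) + odot \<kappa> (q t i) (vel t j))) * cosec t i j ^ 3)
        \<in> polys coords"
        by (intro polys_intros polys_odot Q V C W) (use 3 in auto)
      show "(g has_real_derivative
         sig \<kappa> * cosine t i j * (\<kappa> * (odot \<kappa> (vel t i) (q t j) + odot \<kappa> (q t i) (vel t j))) * cosec t i j ^ 3) (at t)"
        if "t \<in> {0<..<ts}" for t
        unfolding 3(4) by (rule cosec_deriv[OF that 3(1-3)])
    qed
  qed
qed

lemma coords_bounded:
  assumes "0 < e" and t1: "0 < t1" "t1 < ts" and sep: "\<And>t. t \<in> {t1..<ts} \<Longrightarrow> separated e t"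
    and "g \<in> coords"
  shows "\<exists>M. \<forall>t\<in>{t1<..<ts}. \<bar>g t\<bar> \<le> M"
proof -
  obtain V where V: "0 \<le> V" and speed0: "\<And>t i. t \<in> {0<..<ts} \<Longrightarrow> separated e t \<Longrightarrow>
       i \<in> {1..n} \<Longrightarrow> odot \<kappa> (vel t i) (vel t i) \<le> V\<^sup>2"
    using speed_bound[OF \<open>0 < e\<close>] by blast
  have speed: "odot \<kappa> (vel t i) (vel t i) \<le> V\<^sup>2" if "t \<in> {t1..<ts}" "i \<in> {1..n}" for t i
    using speed0[of t i] sep[of t] that t1 by auto
  have root: "\<bar>x\<bar> \<le> sqrt y" if "x\<^sup>2 \<le> y" for x y :: real
    using that by (intro real_le_rsqrt) simp
  from \<open>g \<in> coords\<close> show ?thesis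
  proof (cases rule: coords_cases)
    case (1 i k)
    obtain B where B: "\<And>t k. t \<in> {t1..<ts} \<Longrightarrow> (q t i $ k)\<^sup>2 \<le> B"
      using position_bound[OF t1 V speed 1(1)] by blast
    show ?thesis
    proof (intro exI ballI)
      fix t assume "t \<in> {t1<..<ts}"
      then show "\<bar>g t\<bar> \<le> sqrt B" unfolding 1(2) by (intro root B) auto
    qed
  next
    case (2 i k)
    obtain B where B: "\<And>t k. t \<in> {t1..<ts} \<Longrightarrow> (q t i $ k)\<^sup>2 \<le> B"
      using position_bound[OF t1 V speed 2(1)] by blast
    show ?thesis
    proof (intro exI ballI)
      fix t assume t: "t \<in> {t1<..<ts}"
      show "\<bar>g t\<bar> \<le> sqrt ((m i)\<^sup>2 * (V\<^sup>2 * (1 + \<bar>\<kappa>\<bar> * B)))"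
        unfolding 2(2)
        by (rule root, rule momentum_bound[OF _ 2(1) speed B]) (use t t1 2(1) in auto)
    qed
  next
    case (3 i j)
    show ?thesis
    proof (intro exI ballI)
      fix t assume t: "t \<in> {t1<..<ts}"
      then have "t \<in> {t1..<ts}" by simp
      then have "e \<le> separation t i j" using sep[of t] 3 unfolding separated_def by blast
      then show "\<bar>g t\<bar> \<le> 1 / sqrt e"
        unfolding 3(4) cosec_def using \<open>0 < e\<close> by (simp add: frac_le)
    qed
  qed
qed

text \<open>
  The Taylor series of positions, momenta and \<open>w\<close> are extended independently of each other; that
  they still satisfy the constraints and the equations of motion beyond \<open>ts\<close> is a consequence of the
  identity theorem. Two properties are not identities: \<open>w > 0\<close>, needed to recover the fractional power
  in the force, and \<open>z > 0\<close> on the upper sheet. They persist because \<open>w\<close> cannot vanish by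
  \<open>w\<^sup>2 s = 1\<close>, nor \<open>z\<close> by the equation of the hyperboloid.
\<close>
lemma analytic_extension:
  assumes "0 < e" and t1: "0 < t1" "t1 < ts" and sep: "\<And>t. t \<in> {t1..<ts} \<Longrightarrow> separated e t"
  shows "\<exists>a c Q P. 0 \<le> a \<and> a < ts \<and> ts < c \<and> analytic_solution_on \<kappa> n m {a<..<c} Q P \<and>
    (\<forall>t\<in>{a<..<ts}. \<forall>i\<in>{1..n}. q t i = Q t i \<and> p t i = P t i)"
proof -
  have sub: "{t1<..<ts} \<subseteq> {0<..<ts}" using t1 by auto
  have der: "\<exists>g'\<in>polys coords. \<forall>t\<in>{t1<..<ts}. (g has_real_derivative g' t) (at t)" if "g \<in> coords" for g
    using coords_deriv_poly[OF that] sub by (meson subsetD)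
  have bd: "\<exists>M. \<forall>t\<in>{t1<..<ts}. \<bar>g t\<bar> \<le> M" if "g \<in> coords" for g
    by (rule coords_bounded[OF \<open>0 < e\<close> t1 sep that])
  obtain c r H where cr: "t1 \<le> c - r" "c - r < ts" "ts < c + r"
    and H: "\<And>g. g \<in> coords \<Longrightarrow> holo_ext c r (H g)"
      "\<And>g t. g \<in> coords \<Longrightarrow> t \<in> {c - r<..<ts} \<Longrightarrow> H g t = g t"
    using polynomial_ode_extension[OF t1(2) finite_coords der bd] by blast
  define Q where "Q t i = (\<chi> k. H (\<lambda>t. q t i $ k) t)" for t i
  define P where "P t i = (\<chi> k. H (\<lambda>t. p t i $ k) t)" for t i
  define W where "W t i j = H (\<lambda>t. cosec t i j) t" for t i j
  define C where "C t i j = \<kappa> * odot \<kappa> (Q t i) (Q t j)" for t i j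
  have Qh: "holo_ext c r (\<lambda>t. Q t i $ k)" and Ph: "holo_ext c r (\<lambda>t. P t i $ k)" if "i \<in> {1..n}" for i k
    using H(1)[OF coords_mem(1)[OF that, of k]] H(1)[OF coords_mem(2)[OF that, of k]]
    by (simp_all add: Q_def P_def)
  have Wh: "holo_ext c r (\<lambda>t. W t i j)" if "i \<in> {1..n}" "j \<in> {1..n} - {i}" for i j
    using H(1)[OF coords_mem(3), of i j] that by (auto simp: W_def)
  have Ch: "holo_ext c r (\<lambda>t. C t i j)" if "i \<in> {1..n}" "j \<in> {1..n}" for i j
    unfolding C_def using that by (intro holo_ext_intros holo_ext_odot Qh)
  have Qq: "Q t i = q t i" and Pp: "P t i = p t i" if "t \<in> {c - r<..<ts}" "i \<in> {1..n}" for t i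
    using H(2) coords_mem(1,2) that by (auto simp: Q_def P_def vec_eq_iff)
  have Ww: "W t i j = cosec t i j" if "t \<in> {c - r<..<ts}" "i \<in> {1..n}" "j \<in> {1..n} - {i}" for t i j
    unfolding W_def using that by (intro H(2) coords_mem) auto
  have Cc: "C t i j = cosine t i j" if "t \<in> {c - r<..<ts}" "i \<in> {1..n}" "j \<in> {1..n}" for t i j
    using that by (simp add: C_def cosine_def Qq)
  have old: "t \<in> {0<..<ts}" "t \<in> {0..<ts}" if "t \<in> {c - r<..<ts}" for t
    using that cr t1 by auto
  have subball: "{c - r<..<ts} \<subseteq> ball c r" using cr by (auto simp: ball_eq_greaterThanLessThan)
  note persist = holo_ext_identity[OF _ _ cr(2) subball]
  have surf: "\<kappa> * odot \<kappa> (Q t i) (Q t i) = 1" if "t \<in> ball c r" "i \<in> {1..n}" for t i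
  proof (rule persist[OF _ _ _ that(1)])
    show "holo_ext c r (\<lambda>t. \<kappa> * odot \<kappa> (Q t i) (Q t i))"
      by (intro holo_ext_intros holo_ext_odot Qh that)
    show "\<kappa> * odot \<kappa> (Q s i) (Q s i) = 1" if s: "s \<in> {c - r<..<ts}" for s
      using on_surface[OF old(2)[OF s] \<open>i \<in> {1..n}\<close>] Qq[OF s \<open>i \<in> {1..n}\<close>] by simp
  qed (rule holo_ext_const)
  have tang: "odot \<kappa> (Q t i) (P t i) = 0" if "t \<in> ball c r" "i \<in> {1..n}" for t i
  proof (rule persist[OF _ _ _ that(1)])
    show "holo_ext c r (\<lambda>t. odot \<kappa> (Q t i) (P t i))"
      by (intro holo_ext_intros holo_ext_odot Qh Ph that)
    show "odot \<kappa> (Q s i) (P s i) = 0" if s: "s \<in> {c - r<..<ts}" for s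
      using tangent[OF old(2)[OF s] \<open>i \<in> {1..n}\<close>] Qq[OF s \<open>i \<in> {1..n}\<close>] Pp[OF s \<open>i \<in> {1..n}\<close>] by simp
  qed (rule holo_ext_const)
  have Wgap: "(W t i j)\<^sup>2 * gap \<kappa> (Q t i) (Q t j) = 1"
    if "t \<in> ball c r" "i \<in> {1..n}" "j \<in> {1..n} - {i}" for t i j
  proof (rule persist[OF _ _ _ that(1)])
    have "holo_ext c r (\<lambda>t. (W t i j)\<^sup>2 * (sig \<kappa> * (1 - (C t i j)\<^sup>2)))"
      using that by (intro holo_ext_intros Wh Ch) auto
    then show "holo_ext c r (\<lambda>t. (W t i j)\<^sup>2 * gap \<kappa> (Q t i) (Q t j))"
      by (simp add: gap_def C_def)
    show "(W s i j)\<^sup>2 * gap \<kappa> (Q s i) (Q s j) = 1" if s: "s \<in> {c - r<..<ts}" for s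
      using cosec_pos(2)[OF old(2)[OF s], of i j] Qq[OF s] Ww[OF s] \<open>i \<in> {1..n}\<close> \<open>j \<in> {1..n} - {i}\<close>
      by (simp add: separation_def)
  qed (rule holo_ext_const)
  obtain s where s: "s \<in> {c - r<..<ts}" using cr(2) dense[of "c - r" ts] by auto
  have sb: "s \<in> ball c r" using s subball by blast
  have Wpos: "0 < W t i j" if "t \<in> ball c r" "i \<in> {1..n}" "j \<in> {1..n} - {i}" for t i j
  proof (rule holo_ext_pos[OF Wh _ sb _ that(1)])
    show "W t i j \<noteq> 0" if "t \<in> ball c r" for t
      using Wgap[OF that \<open>i \<in> {1..n}\<close> \<open>j \<in> {1..n} - {i}\<close>] by auto
    show "0 < W s i j"
      using cosec_pos(1)[OF old(2)[OF s], of i j] Ww[OF s] that by simp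
  qed (use that in auto)
  have M: "Q t i \<in> M2 \<kappa>" if t: "t \<in> ball c r" and i: "i \<in> {1..n}" for t i
  proof -
    have "0 < Q t i $ 3" if "\<kappa> < 0"
    proof (rule holo_ext_pos[OF Qh[OF i] _ sb _ t])
      show "Q u i $ 3 \<noteq> 0" if u: "u \<in> ball c r" for u
      proof
        assume "Q u i $ 3 = 0"
        then have "\<kappa> * ((Q u i $ 1)\<^sup>2 + (Q u i $ 2)\<^sup>2) = 1"
          using surf[OF u i] by (simp add: odot_def power2_eq_square)
        moreover have "\<kappa> * ((Q u i $ 1)\<^sup>2 + (Q u i $ 2)\<^sup>2) \<le> 0"
          using \<open>\<kappa> < 0\<close> by (intro mult_nonpos_nonneg) auto
        ultimately show False by simp
      qed
      show "0 < Q s i $ 3"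
        using in_M2[OF old(2)[OF s] i] Qq[OF s i] \<open>\<kappa> < 0\<close> by (simp add: M2_def)
    qed
    then show ?thesis
      using surf[OF t i] by (simp add: M2_def odot_def power2_eq_square mult_ac)
  qed
  have Qd: "((\<lambda>s. Q s i) has_vector_derivative (1 / m i) *\<^sub>R P t i) (at t)"
    if t: "t \<in> ball c r" and i: "i \<in> {1..n}" for t i
  proof (rule vec_has_vector_derivative)
    fix k
    have "((\<lambda>s. Q s i $ k) has_real_derivative P t i $ k * (1 / m i)) (at t)"
    proof (rule holo_ext_transfer_deriv[OF Qh[OF i] _ cr(2,3) _ _ t])
      show "holo_ext c r (\<lambda>t. P t i $ k * (1 / m i))" by (intro holo_ext_intros Ph i)
      show "((\<lambda>s. q s i $ k) has_real_derivative P u i $ k * (1 / m i)) (at u)"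
        if "u \<in> {c - r<..<ts}" for u
        using q_comp_deriv[OF old(1)[OF that] i, of k] Pp[OF that i] by simp
      show "Q u i $ k = q u i $ k" if "u \<in> {c - r<..<ts}" for u using Qq[OF that i] by simp
    qed
    then show "((\<lambda>s. Q s i $ k) has_real_derivative ((1 / m i) *\<^sub>R P t i) $ k) (at t)" by simp
  qed
  have Pd: "((\<lambda>s. P s i) has_vector_derivative
      grad_U \<kappa> n m (Q t) i - ((1 / m i) * \<kappa> * odot \<kappa> (P t i) (P t i)) *\<^sub>R Q t i) (at t)"
    if t: "t \<in> ball c r" and i: "i \<in> {1..n}" for t i
  proof (rule vec_has_vector_derivative)
    fix k
    define D where "D t = (\<Sum>j\<in>{1..n} - {i}. m i * m j * \<bar>\<kappa>\<bar> powr (3/2) * W t i j ^ 3 * (Q t j $ k - C t i j * Q t i $ k))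
        - (1 / m i) * \<kappa> * odot \<kappa> (P t i) (P t i) * Q t i $ k" for t
    have "((\<lambda>s. P s i $ k) has_real_derivative D t) (at t)"
    proof (rule holo_ext_transfer_deriv[OF Ph[OF i] _ cr(2,3) _ _ t])
      show "holo_ext c r D" unfolding D_def
        by (intro holo_ext_intros holo_ext_odot Qh Ph Ch Wh i) auto
      show "((\<lambda>s. p s i $ k) has_real_derivative D u) (at u)" if u: "u \<in> {c - r<..<ts}" for u
      proof -
        have "D u = (\<Sum>j\<in>{1..n} - {i}. m i * m j * \<bar>\<kappa>\<bar> powr (3/2) * cosec u i j ^ 3 * (q u j $ k - cosine u i j * q u i $ k))
        - (1 / m i) * \<kappa> * odot \<kappa> (p u i) (p u i) * q u i $ k"
          unfolding D_def using Qq[OF u] Pp[OF u] Ww[OF u] Cc[OF u] i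
          by (intro arg_cong2[where f = "(-)"] sum.cong) auto
        then show ?thesis using p_comp_deriv[OF old(1)[OF u] i, of k] by simp
      qed
      show "P u i $ k = p u i $ k" if "u \<in> {c - r<..<ts}" for u using Pp[OF that i] by simp
    qed
    moreover have "(grad_U \<kappa> n m (Q t) i - ((1 / m i) * \<kappa> * odot \<kappa> (P t i) (P t i)) *\<^sub>R Q t i) $ k = D t"
    proof -
      have "grad_U \<kappa> n m (Q t) i = (\<Sum>j\<in>{1..n} - {i}.
         (m i * m j * \<bar>\<kappa>\<bar> powr (3/2) * W t i j ^ 3) *\<^sub>R (Q t j - (\<kappa> * odot \<kappa> (Q t i) (Q t j)) *\<^sub>R Q t i))"
        by (rule grad_U_eq) (use surf[OF t] Wpos[OF t i] Wgap[OF t i] i in auto)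
      then show ?thesis by (simp add: D_def C_def)
    qed
    ultimately show "((\<lambda>s. P s i $ k) has_real_derivative
       (grad_U \<kappa> n m (Q t) i - ((1 / m i) * \<kappa> * odot \<kappa> (P t i) (P t i)) *\<^sub>R Q t i) $ k) (at t)"
      by simp
  qed
  have "Q t \<notin> singular_set \<kappa> n" if t: "t \<in> ball c r" for t
  proof
    assume "Q t \<in> singular_set \<kappa> n"
    then obtain i j where ij: "1 \<le> i" "i < j" "j \<le> n" "(\<kappa> * odot \<kappa> (Q t i) (Q t j))\<^sup>2 = 1"
      by (auto simp: singular_set_def)
    then have "(W t i j)\<^sup>2 * gap \<kappa> (Q t i) (Q t j) = 1" by (intro Wgap[OF t]) auto
    moreover have "gap \<kappa> (Q t i) (Q t j) = 0" using ij(4) by (simp add: gap_eq_0_iff)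
    ultimately show False by simp
  qed
  then have "analytic_solution_on \<kappa> n m (ball c r) Q P"
    unfolding analytic_solution_on_def solution_on_def
    using M tang Qd Pd holo_ext_real_analytic[OF Qh] holo_ext_real_analytic[OF Ph]
    by (blast intro: has_vector_derivative_at_within)
  then have "analytic_solution_on \<kappa> n m {c - r<..<c + r} Q P"
    by (simp only: ball_eq_greaterThanLessThan)
  moreover have "0 \<le> c - r" using cr t1 by simp
  ultimately show ?thesis using cr Qq Pp
    by (intro exI[of _ "c - r"] exI[of _ "c + r"] exI[of _ Q] exI[of _ P]) simp
qed

end

theorem theorem1:
  fixes \<kappa> tstar :: real and n :: nat and m :: "nat \<Rightarrow> real"
    and q p :: "real \<Rightarrow> nat \<Rightarrow> real ^ 3"
  assumes "\<kappa> \<noteq> 0" and "n \<ge> 2"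
    and "\<And>i. i \<in> {1..n} \<Longrightarrow> m i > 0"
    and "0 < tstar"
    and "analytic_solution_on \<kappa> n m {0..<tstar} q p"
    and "singularity \<kappa> n m q p tstar"
  shows "((\<lambda>t. Min {\<bar>(\<kappa> * odot \<kappa> (q t i) (q t j))\<^sup>2 - 1\<bar> | i j. 1 \<le> i \<and> i < j \<and> j \<le> n})
            \<longlongrightarrow> 0) (at_left tstar)"
proof (rule ccontr)
  let ?S = "\<lambda>t. {\<bar>(\<kappa> * odot \<kappa> (q t i) (q t j))\<^sup>2 - 1\<bar> | i j. 1 \<le> i \<and> i < j \<and> j \<le> n}"
  interpret curved_motion \<kappa> n m tstar q p
    by standard (use assms in \<open>auto simp: analytic_solution_on_def\<close>)
  have fin: "finite (?S t)" for t
  proof (rule finite_subset)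
    show "?S t \<subseteq> (\<lambda>(i, j). \<bar>(\<kappa> * odot \<kappa> (q t i) (q t j))\<^sup>2 - 1\<bar>) ` ({1..n} \<times> {1..n})"
      by (force simp: image_iff)
  qed auto
  have "\<exists>i j. 1 \<le> i \<and> i < j \<and> j \<le> n"
    by (rule exI[of _ 1], rule exI[of _ 2]) (use \<open>n \<ge> 2\<close> in simp)
  then have ne: "?S t \<noteq> {}" for t by blast
  have Min0: "0 \<le> Min (?S t)" for t
    using fin ne by (subst Min_ge_iff) auto
  assume "\<not> ((\<lambda>t. Min (?S t)) \<longlongrightarrow> 0) (at_left tstar)"
  then obtain e where e: "0 < e" and freq: "\<not> (\<forall>\<^sub>F t in at_left tstar. dist (Min (?S t)) 0 < e)"
    unfolding tendsto_iff by blast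
  have recur: "\<exists>t. b < t \<and> t < tstar \<and> separated e t" if b: "b < tstar" for b
  proof -
    define b' where "b' = max b 0"
    have b': "b' < tstar" using b \<open>0 < tstar\<close> by (simp add: b'_def)
    obtain t where t: "b' < t" "t < tstar" "\<not> dist (Min (?S t)) 0 < e"
      using freq b' unfolding eventually_at_left[OF b'] by blast
    then have Me: "e \<le> Min (?S t)" using Min0[of t] by (simp add: dist_real_def)
    have t0: "t \<in> {0..<tstar}" using t by (simp add: b'_def)
    have less: "e \<le> separation t i j" if "i \<in> {1..n}" "j \<in> {1..n}" "i < j" for i j
    proof -
      have "Min (?S t) \<le> \<bar>(\<kappa> * odot \<kappa> (q t i) (q t j))\<^sup>2 - 1\<bar>"
        by (rule Min_le[OF fin]) (use that in auto)
      then show ?thesis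
        using Me that gap_eq_abs[OF on_surface[OF t0] on_surface[OF t0], of i j]
        by (simp add: separation_def)
    qed
    have "separated e t" unfolding separated_def
    proof (intro ballI impI)
      fix i j assume ij: "i \<in> {1..n}" "j \<in> {1..n}" "i \<noteq> j"
      then consider "i < j" | "j < i" by linarith
      then show "e \<le> separation t i j"
        using less[OF ij(1,2)] less[OF ij(2,1)] by cases (simp_all add: separation_def gap_commute)
    qed
    then show ?thesis using t by (intro exI[of _ t]) (simp add: b'_def)
  qed
  obtain t1 where t1: "0 < t1" "t1 < tstar" "\<forall>t\<in>{t1..<tstar}. separated (e / 2) t"
    using separation_persists[OF e recur] by blast
  obtain a c Q P where ext: "0 \<le> a" "a < tstar" "tstar < c" "analytic_solution_on \<kappa> n m {a<..<c} Q P"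
    "\<forall>t\<in>{a<..<tstar}. \<forall>i\<in>{1..n}. q t i = Q t i \<and> p t i = P t i"
    using analytic_extension[of "e / 2" t1] e t1 by auto
  have "analytic_solution_on \<kappa> n m {0..<c}
    (\<lambda>t i. if t < tstar then q t i else Q t i) (\<lambda>t i. if t < tstar then p t i else P t i)"
    by (rule solution_glue[OF assms(5) ext(4,1,2,3)]) (use ext(5) in blast)
  moreover have "\<forall>t\<in>{0..<tstar}. \<forall>i\<in>{1..n}. (if t < tstar then q t i else Q t i) = q t i \<and>
      (if t < tstar then p t i else P t i) = p t i" by simp
  ultimately show False
    using assms(6) ext(3) unfolding singularity_def by blast
qed

end
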